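(* Let $\mathcal{C}$ be a complete category and $B\colon\mathcal{C}\to\mathcal{C}$ an endofunctor such that the codensity monad $\mathrm{Ran}_{\bar B}\bar B$ of its final sequence exists, $B$ preserves it, and $B_{k+1,k}\colon B_{k+1}\to B_k$ is an isomorphism for some ordinal $k$ (so $(B_k,B_{k+1,k}^{-1})$ is a final $B$-coalgebra). Let $F\colon\mathcal{C}\to\mathcal{C}$ be a functor with free monad $F^*$. Then every algebra $\alpha\colon FB_k\to B_k$ induced on the final coalgebra by an abstract GSOS specification $\lambda\colon F(B\times\mathrm{Id})\Rightarrow BF^*$ is definable by a distributive law over $B$: there exist a functor $G$, a natural transformation $\rho\colon GB\Rightarrow BG$ with induced algebra $\beta\colon GB_k\to B_k$, and a natural transformation $\kappa\colon F\Rightarrow G$ with $\alpha=\beta\circ\kappa_{B_k}$.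
   Context: Final sequence: $B_0=1$, $B_{i+1}=BB_i$, $B_j=\lim_{i<j}B_i$ at limit $j$, connecting maps $B_{j,i}$ with $B_{i,i}=\mathrm{id}$, $B_{j+1,i+1}=BB_{j,i}$; functor $\bar B\colon\mathrm{Ord}^{op}\to\mathcal{C}$. Codensity monad: right Kan extension $(\mathrm{Ran}_{\bar B}\bar B,\epsilon)$ of $\bar B$ along itself ($\epsilon\colon(\mathrm{Ran}_{\bar B}\bar B)\bar B\Rightarrow\bar B$ through which every $H\bar B\Rightarrow\bar B$ factors uniquely as $\epsilon\circ\hat\alpha\bar B$); $B$ preserves it if $(B\circ\mathrm{Ran}_{\bar B}\bar B,B\epsilon)$ is a right Kan extension of $B\bar B$ along $\bar B$. For a final coalgebra $(Z,\zeta)$, the algebra induced by an abstract GSOS $\lambda$ is the unique $\alpha\colon FZ\to Z$ with $\zeta\circ\alpha=B\alpha^*\circ\lambda_Z\circ F\langle\zeta,\mathrm{id}\rangle$, where $\alpha^*\colon F^*Z\to Z$ is the Eilenberg–Moore algebra of the free monad corresponding to $\alpha$. The algebra induced by $\rho\colon GB\Rightarrow BG$ is the unique $\beta\colon GZ\to Z$ with $\zeta\circ\beta=B\beta\circ\rho_Z\circ G\zeta$. *)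

theory Defs
  imports Main
begin

unbundle cardinal_syntax

section \<open>Categories, functors, natural transformations\<close>

record ('o, 'm) cat =
  Obj :: "'o set"
  Arr :: "'m set"
  Dom :: "'m \<Rightarrow> 'o"
  Cod :: "'m \<Rightarrow> 'o"
  Ide :: "'o \<Rightarrow> 'm"
  Cmp :: "'m \<Rightarrow> 'm \<Rightarrow> 'm"  (infixr "\<cdot>\<index>" 70)

definition Hom :: "('o, 'm) cat \<Rightarrow> 'o \<Rightarrow> 'o \<Rightarrow> 'm set" where
  "Hom C a b = {f \<in> Arr C. Dom C f = a \<and> Cod C f = b}"

locale category =
  fixes C :: "('o, 'm) cat" (structure)
  assumes Dom_Obj: "f \<in> Arr C \<Longrightarrow> Dom C f \<in> Obj C"
    and Cod_Obj: "f \<in> Arr C \<Longrightarrow> Cod C f \<in> Obj C"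
    and Ide_Hom: "a \<in> Obj C \<Longrightarrow> Ide C a \<in> Hom C a a"
    and Cmp_Hom: "f \<in> Hom C a b \<Longrightarrow> g \<in> Hom C b c \<Longrightarrow> g \<cdot> f \<in> Hom C a c"
    and Cmp_Ide_right: "f \<in> Hom C a b \<Longrightarrow> f \<cdot> Ide C a = f"
    and Cmp_Ide_left: "f \<in> Hom C a b \<Longrightarrow> Ide C b \<cdot> f = f"
    and Cmp_assoc: "f \<in> Hom C a b \<Longrightarrow> g \<in> Hom C b c \<Longrightarrow> h \<in> Hom C c d
      \<Longrightarrow> h \<cdot> (g \<cdot> f) = (h \<cdot> g) \<cdot> f"

definition opposite :: "('o, 'm) cat \<Rightarrow> ('o, 'm) cat" where
  "opposite C = \<lparr>Obj = Obj C, Arr = Arr C, Dom = Cod C, Cod = Dom C,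
                 Ide = Ide C, Cmp = (\<lambda>g f. Cmp C f g)\<rparr>"

text \<open>A reflexive and transitive relation as a category; the pair \<open>(i, j)\<close> is the unique arrow
  from \<open>i\<close> to \<open>j\<close>.\<close>

definition order_cat :: "'i rel \<Rightarrow> ('i, 'i \<times> 'i) cat" where
  "order_cat r = \<lparr>Obj = Field r, Arr = r, Dom = fst, Cod = snd,
                  Ide = (\<lambda>i. (i, i)), Cmp = (\<lambda>g f. (fst f, snd g))\<rparr>"

definition is_inverse :: "('o, 'm) cat \<Rightarrow> 'm \<Rightarrow> 'm \<Rightarrow> bool" where
  "is_inverse C f g \<longleftrightarrow> f \<in> Arr C \<and> g \<in> Hom C (Cod C f) (Dom C f)
     \<and> Cmp C g f = Ide C (Dom C f) \<and> Cmp C f g = Ide C (Cod C f)"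

definition is_iso :: "('o, 'm) cat \<Rightarrow> 'm \<Rightarrow> bool" where
  "is_iso C f \<longleftrightarrow> (\<exists>g. is_inverse C f g)"

definition inv_arr :: "('o, 'm) cat \<Rightarrow> 'm \<Rightarrow> 'm" where
  "inv_arr C f = (THE g. is_inverse C f g)"

record ('o, 'm, 'p, 'n) fctr =
  fobj :: "'o \<Rightarrow> 'p"
  farr :: "'m \<Rightarrow> 'n"

definition is_functor :: "('o, 'm) cat \<Rightarrow> ('p, 'n) cat \<Rightarrow> ('o, 'm, 'p, 'n) fctr \<Rightarrow> bool" where
  "is_functor A D F \<longleftrightarrow>
     (\<forall>a \<in> Obj A. fobj F a \<in> Obj D) \<and>
     (\<forall>f \<in> Arr A. farr F f \<in> Hom D (fobj F (Dom A f)) (fobj F (Cod A f))) \<and>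
     (\<forall>a \<in> Obj A. farr F (Ide A a) = Ide D (fobj F a)) \<and>
     (\<forall>f \<in> Arr A. \<forall>g \<in> Arr A. Dom A g = Cod A f \<longrightarrow>
        farr F (Cmp A g f) = Cmp D (farr F g) (farr F f))"

definition id_fctr :: "('o, 'm, 'o, 'm) fctr" where
  "id_fctr = \<lparr>fobj = (\<lambda>a. a), farr = (\<lambda>f. f)\<rparr>"

definition comp_fctr ::
  "('p, 'n, 'q, 'l) fctr \<Rightarrow> ('o, 'm, 'p, 'n) fctr \<Rightarrow> ('o, 'm, 'q, 'l) fctr"  (infixr "\<circ>\<^sub>F" 75) where
  "G \<circ>\<^sub>F F = \<lparr>fobj = (\<lambda>a. fobj G (fobj F a)), farr = (\<lambda>f. farr G (farr F f))\<rparr>"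

definition is_nat ::
  "('o, 'm) cat \<Rightarrow> ('p, 'n) cat \<Rightarrow> ('o, 'm, 'p, 'n) fctr \<Rightarrow> ('o, 'm, 'p, 'n) fctr
    \<Rightarrow> ('o \<Rightarrow> 'n) \<Rightarrow> bool" where
  "is_nat A D F G \<tau> \<longleftrightarrow> is_functor A D F \<and> is_functor A D G \<and>
     (\<forall>a \<in> Obj A. \<tau> a \<in> Hom D (fobj F a) (fobj G a)) \<and>
     (\<forall>f \<in> Arr A. Cmp D (farr G f) (\<tau> (Dom A f)) = Cmp D (\<tau> (Cod A f)) (farr F f))"


section \<open>Limits and completeness\<close>

definition is_terminal :: "('o, 'm) cat \<Rightarrow> 'o \<Rightarrow> bool" where
  "is_terminal C t \<longleftrightarrow> t \<in> Obj C \<and> (\<forall>a \<in> Obj C. \<exists>!f. f \<in> Hom C a t)"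

definition is_cone ::
  "('j, 'k) cat \<Rightarrow> ('o, 'm) cat \<Rightarrow> ('j, 'k, 'o, 'm) fctr \<Rightarrow> 'o \<Rightarrow> ('j \<Rightarrow> 'm) \<Rightarrow> bool" where
  "is_cone J C D c \<pi> \<longleftrightarrow> c \<in> Obj C \<and>
     (\<forall>j \<in> Obj J. \<pi> j \<in> Hom C c (fobj D j)) \<and>
     (\<forall>f \<in> Arr J. Cmp C (farr D f) (\<pi> (Dom J f)) = \<pi> (Cod J f))"

definition is_limit ::
  "('j, 'k) cat \<Rightarrow> ('o, 'm) cat \<Rightarrow> ('j, 'k, 'o, 'm) fctr \<Rightarrow> 'o \<Rightarrow> ('j \<Rightarrow> 'm) \<Rightarrow> bool" where
  "is_limit J C D c \<pi> \<longleftrightarrow> is_cone J C D c \<pi> \<and>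
     (\<forall>x \<xi>. is_cone J C D x \<xi> \<longrightarrow>
        (\<exists>!h. h \<in> Hom C x c \<and> (\<forall>j \<in> Obj J. Cmp C (\<pi> j) h = \<xi> j)))"

definition is_product :: "('o, 'm) cat \<Rightarrow> 'o \<Rightarrow> 'o \<Rightarrow> 'o \<Rightarrow> 'm \<Rightarrow> 'm \<Rightarrow> bool" where
  "is_product C a b c p q \<longleftrightarrow>
     a \<in> Obj C \<and> b \<in> Obj C \<and> c \<in> Obj C \<and> p \<in> Hom C c a \<and> q \<in> Hom C c b \<and>
     (\<forall>x \<in> Obj C. \<forall>f \<in> Hom C x a. \<forall>g \<in> Hom C x b.
        \<exists>!h. h \<in> Hom C x c \<and> Cmp C p h = f \<and> Cmp C q h = g)"

definition pairing :: "('o, 'm) cat \<Rightarrow> 'm \<Rightarrow> 'm \<Rightarrow> 'm \<Rightarrow> 'm \<Rightarrow> 'm" where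
  "pairing C p q f g =
     (THE h. h \<in> Hom C (Dom C f) (Dom C p) \<and> Cmp C p h = f \<and> Cmp C q h = g)"

definition is_product_fctr ::
  "('o, 'm) cat \<Rightarrow> ('o, 'm, 'o, 'm) fctr \<Rightarrow> ('o, 'm, 'o, 'm) fctr \<Rightarrow> ('o, 'm, 'o, 'm) fctr
    \<Rightarrow> ('o \<Rightarrow> 'm) \<Rightarrow> ('o \<Rightarrow> 'm) \<Rightarrow> bool" where
  "is_product_fctr C F G P p q \<longleftrightarrow> is_nat C C P F p \<and> is_nat C C P G q \<and>
     (\<forall>x \<in> Obj C. is_product C (fobj F x) (fobj G x) (fobj P x) (p x) (q x))"

text \<open>
  HOL has no proper classes, so the size of the set-theoretic universe is a parameter: a
  cardinal \<open>\<Omega>\<close>, represented as a well-order of minimal order type.  ``Small'' means of cardinality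
  below \<open>\<Omega>\<close>, and \<open>Ord\<close> is \<open>\<Omega>\<close> itself, viewed as a linearly ordered category: its elements are the
  small ordinals.  The usual universes are the inaccessible \<open>\<Omega>\<close>; only regularity is
  required, since HOL does not prove that uncountable inaccessible cardinals exist.
\<close>

definition universe_size :: "'u rel \<Rightarrow> bool" where
  "universe_size \<Omega> \<longleftrightarrow> Cinfinite \<Omega> \<and> regularCard \<Omega>"

definition small_category :: "'u rel \<Rightarrow> ('j, 'k) cat \<Rightarrow> bool" where
  "small_category \<Omega> J \<longleftrightarrow> category J \<and> |Obj J| <o \<Omega> \<and> |Arr J| <o \<Omega>"

text \<open>Every small category is isomorphic to one whose objects and arrows are elements of \<open>'u\<close>, so
  it suffices to consider diagrams of the latter shape.\<close>

definition complete_category :: "'u rel \<Rightarrow> ('o, 'm) cat \<Rightarrow> bool" where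
  "complete_category \<Omega> C \<longleftrightarrow> category C \<and>
     (\<forall>(J :: ('u, 'u) cat) D. small_category \<Omega> J \<longrightarrow> is_functor J C D \<longrightarrow>
        (\<exists>c \<pi>. is_limit J C D c \<pi>))"


section \<open>The final sequence\<close>

definition ord_zero :: "'u rel \<Rightarrow> 'u \<Rightarrow> bool" where
  "ord_zero \<Omega> i \<longleftrightarrow> i \<in> Field \<Omega> \<and> underS \<Omega> i = {}"

definition ord_suc :: "'u rel \<Rightarrow> 'u \<Rightarrow> 'u" where
  "ord_suc \<Omega> i = wo_rel.suc \<Omega> {i}"

definition ord_limit :: "'u rel \<Rightarrow> 'u \<Rightarrow> bool" where
  "ord_limit \<Omega> j \<longleftrightarrow> j \<in> Field \<Omega> \<and> \<not> ord_zero \<Omega> j \<and> (\<forall>i \<in> Field \<Omega>. j \<noteq> ord_suc \<Omega> i)"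

abbreviation Ord_op :: "'u rel \<Rightarrow> ('u, 'u \<times> 'u) cat" where
  "Ord_op \<Omega> \<equiv> opposite (order_cat \<Omega>)"

text \<open>The connecting map \<open>B\<^bsub>j,i\<^esub>\<close> for \<open>i \<le> j\<close>, of type \<open>B\<^sub>j \<rightarrow> B\<^sub>i\<close>.\<close>

abbreviation conn :: "('u, 'u \<times> 'u, 'o, 'm) fctr \<Rightarrow> 'u \<Rightarrow> 'u \<Rightarrow> 'm" where
  "conn S j i \<equiv> farr S (i, j)"

text \<open>The terminal object and the limits are determined only up to isomorphism; a final sequence
  is the result of any choice of them.  The identity law for the connecting maps is part of
  functoriality.\<close>

definition is_final_sequence ::
  "'u rel \<Rightarrow> ('o, 'm) cat \<Rightarrow> ('o, 'm, 'o, 'm) fctr \<Rightarrow> ('u, 'u \<times> 'u, 'o, 'm) fctr \<Rightarrow> bool" where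
  "is_final_sequence \<Omega> C B S \<longleftrightarrow> is_functor (Ord_op \<Omega>) C S \<and>
     (\<forall>i. ord_zero \<Omega> i \<longrightarrow> is_terminal C (fobj S i)) \<and>
     (\<forall>i \<in> Field \<Omega>. fobj S (ord_suc \<Omega> i) = fobj B (fobj S i)) \<and>
     (\<forall>i j. (i, j) \<in> \<Omega> \<longrightarrow>
        conn S (ord_suc \<Omega> j) (ord_suc \<Omega> i) = farr B (conn S j i)) \<and>
     (\<forall>j. ord_limit \<Omega> j \<longrightarrow>
        is_limit (Ord_op (Restr \<Omega> (underS \<Omega> j))) C S (fobj S j) (\<lambda>i. conn S j i))"


section \<open>Right Kan extensions\<close>

text \<open>\<open>(R, \<epsilon>)\<close> is a right Kan extension of \<open>X : A \<rightarrow> E\<close> along \<open>K : A \<rightarrow> D\<close>.  Transformations are total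
  functions, so uniqueness is understood on the objects of \<open>D\<close>.\<close>

definition is_right_kan_extension ::
  "('a, 'b) cat \<Rightarrow> ('d, 'e) cat \<Rightarrow> ('f, 'g) cat
    \<Rightarrow> ('a, 'b, 'd, 'e) fctr \<Rightarrow> ('a, 'b, 'f, 'g) fctr
    \<Rightarrow> ('d, 'e, 'f, 'g) fctr \<Rightarrow> ('a \<Rightarrow> 'g) \<Rightarrow> bool" where
  "is_right_kan_extension A D E K X R \<epsilon> \<longleftrightarrow>
     is_functor A D K \<and> is_functor A E X \<and> is_functor D E R \<and>
     is_nat A E (R \<circ>\<^sub>F K) X \<epsilon> \<and>
     (\<forall>H \<alpha>. is_functor D E H \<longrightarrow> is_nat A E (H \<circ>\<^sub>F K) X \<alpha> \<longrightarrow>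
        (\<exists>\<tau>. is_nat D E H R \<tau> \<and>
           (\<forall>a \<in> Obj A. \<alpha> a = Cmp E (\<epsilon> a) (\<tau> (fobj K a))) \<and>
           (\<forall>\<sigma>. is_nat D E H R \<sigma> \<and>
              (\<forall>a \<in> Obj A. \<alpha> a = Cmp E (\<epsilon> a) (\<sigma> (fobj K a))) \<longrightarrow>
              (\<forall>d \<in> Obj D. \<sigma> d = \<tau> d))))"

definition is_codensity ::
  "('a, 'b) cat \<Rightarrow> ('o, 'm) cat \<Rightarrow> ('a, 'b, 'o, 'm) fctr
    \<Rightarrow> ('o, 'm, 'o, 'm) fctr \<Rightarrow> ('a \<Rightarrow> 'm) \<Rightarrow> bool" where
  "is_codensity A C K R \<epsilon> \<longleftrightarrow> is_right_kan_extension A C C K K R \<epsilon>"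

definition preserves_codensity ::
  "('a, 'b) cat \<Rightarrow> ('o, 'm) cat \<Rightarrow> ('o, 'm, 'o, 'm) fctr \<Rightarrow> ('a, 'b, 'o, 'm) fctr
    \<Rightarrow> ('o, 'm, 'o, 'm) fctr \<Rightarrow> ('a \<Rightarrow> 'm) \<Rightarrow> bool" where
  "preserves_codensity A C B K R \<epsilon> \<longleftrightarrow>
     is_right_kan_extension A C C K (B \<circ>\<^sub>F K) (B \<circ>\<^sub>F R) (\<lambda>a. farr B (\<epsilon> a))"


section \<open>Coalgebras, monads and free monads\<close>

definition is_coalgebra ::
  "('o, 'm) cat \<Rightarrow> ('o, 'm, 'o, 'm) fctr \<Rightarrow> 'o \<Rightarrow> 'm \<Rightarrow> bool" where
  "is_coalgebra C B x \<xi> \<longleftrightarrow> x \<in> Obj C \<and> \<xi> \<in> Hom C x (fobj B x)"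

definition is_final_coalgebra ::
  "('o, 'm) cat \<Rightarrow> ('o, 'm, 'o, 'm) fctr \<Rightarrow> 'o \<Rightarrow> 'm \<Rightarrow> bool" where
  "is_final_coalgebra C B z \<zeta> \<longleftrightarrow> is_coalgebra C B z \<zeta> \<and>
     (\<forall>x \<xi>. is_coalgebra C B x \<xi> \<longrightarrow>
        (\<exists>!h. h \<in> Hom C x z \<and> Cmp C \<zeta> h = Cmp C (farr B h) \<xi>))"

definition is_algebra ::
  "('o, 'm) cat \<Rightarrow> ('o, 'm, 'o, 'm) fctr \<Rightarrow> 'o \<Rightarrow> 'm \<Rightarrow> bool" where
  "is_algebra C F x \<alpha> \<longleftrightarrow> x \<in> Obj C \<and> \<alpha> \<in> Hom C (fobj F x) x"

definition is_monad ::
  "('o, 'm) cat \<Rightarrow> ('o, 'm, 'o, 'm) fctr \<Rightarrow> ('o \<Rightarrow> 'm) \<Rightarrow> ('o \<Rightarrow> 'm) \<Rightarrow> bool" where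
  "is_monad C T \<eta> \<mu> \<longleftrightarrow> is_nat C C id_fctr T \<eta> \<and> is_nat C C (T \<circ>\<^sub>F T) T \<mu> \<and>
     (\<forall>x \<in> Obj C.
        Cmp C (\<mu> x) (\<eta> (fobj T x)) = Ide C (fobj T x) \<and>
        Cmp C (\<mu> x) (farr T (\<eta> x)) = Ide C (fobj T x) \<and>
        Cmp C (\<mu> x) (\<mu> (fobj T x)) = Cmp C (\<mu> x) (farr T (\<mu> x)))"

definition is_EM_algebra ::
  "('o, 'm) cat \<Rightarrow> ('o, 'm, 'o, 'm) fctr \<Rightarrow> ('o \<Rightarrow> 'm) \<Rightarrow> ('o \<Rightarrow> 'm) \<Rightarrow> 'o \<Rightarrow> 'm \<Rightarrow> bool" where
  "is_EM_algebra C T \<eta> \<mu> x a \<longleftrightarrow> is_algebra C T x a \<and>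
     Cmp C a (\<eta> x) = Ide C x \<and> Cmp C a (\<mu> x) = Cmp C a (farr T a)"

text \<open>The free monad \<open>(T, \<eta>, \<mu>)\<close> on \<open>F\<close>, with inclusion \<open>\<iota> : F \<Rightarrow> T\<close>, is the monad of the
  adjunction between \<open>C\<close> and the \<open>F\<close>-algebras: \<open>T x\<close> carries the free \<open>F\<close>-algebra on \<open>x\<close>, with
  structure map \<open>\<mu>\<^sub>x \<circ> \<iota>\<^bsub>T x\<^esub>\<close> and unit \<open>\<eta>\<^sub>x\<close>.\<close>

definition is_free_monad ::
  "('o, 'm) cat \<Rightarrow> ('o, 'm, 'o, 'm) fctr \<Rightarrow> ('o, 'm, 'o, 'm) fctr
    \<Rightarrow> ('o \<Rightarrow> 'm) \<Rightarrow> ('o \<Rightarrow> 'm) \<Rightarrow> ('o \<Rightarrow> 'm) \<Rightarrow> bool" where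
  "is_free_monad C F T \<eta> \<mu> \<iota> \<longleftrightarrow> is_monad C T \<eta> \<mu> \<and> is_nat C C F T \<iota> \<and>
     (\<forall>x \<in> Obj C. \<forall>y a. \<forall>f \<in> Hom C x y. is_algebra C F y a \<longrightarrow>
        (\<exists>!h. h \<in> Hom C (fobj T x) y \<and> Cmp C h (\<eta> x) = f \<and>
           Cmp C h (Cmp C (\<mu> x) (\<iota> (fobj T x))) = Cmp C a (farr F h)))"

definition EM_ext ::
  "('o, 'm) cat \<Rightarrow> ('o, 'm, 'o, 'm) fctr \<Rightarrow> ('o \<Rightarrow> 'm) \<Rightarrow> ('o \<Rightarrow> 'm) \<Rightarrow> ('o \<Rightarrow> 'm)
    \<Rightarrow> 'o \<Rightarrow> 'm \<Rightarrow> 'm" where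
  "EM_ext C T \<eta> \<mu> \<iota> x \<alpha> = (THE a. is_EM_algebra C T \<eta> \<mu> x a \<and> Cmp C a (\<iota> x) = \<alpha>)"


section \<open>Induced algebras\<close>

text \<open>\<open>P\<close> with projections \<open>p\<close>, \<open>q\<close> is the functor \<open>B \<times> Id\<close>.\<close>

definition gsos_equation where
  "gsos_equation C B F T \<eta> \<mu> \<iota> p q l z \<zeta> \<alpha> \<longleftrightarrow>
     Cmp C \<zeta> \<alpha> =
       Cmp C (farr B (EM_ext C T \<eta> \<mu> \<iota> z \<alpha>))
         (Cmp C (l z) (farr F (pairing C (p z) (q z) \<zeta> (Ide C z))))"

definition gsos_induced ::
  "('o, 'm) cat \<Rightarrow> ('o, 'm, 'o, 'm) fctr \<Rightarrow> ('o, 'm, 'o, 'm) fctr \<Rightarrow> ('o, 'm, 'o, 'm) fctr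
    \<Rightarrow> ('o \<Rightarrow> 'm) \<Rightarrow> ('o \<Rightarrow> 'm) \<Rightarrow> ('o \<Rightarrow> 'm) \<Rightarrow> ('o \<Rightarrow> 'm) \<Rightarrow> ('o \<Rightarrow> 'm)
    \<Rightarrow> ('o \<Rightarrow> 'm) \<Rightarrow> 'o \<Rightarrow> 'm \<Rightarrow> 'm \<Rightarrow> bool" where
  "gsos_induced C B F T \<eta> \<mu> \<iota> p q l z \<zeta> \<alpha> \<longleftrightarrow>
     is_algebra C F z \<alpha> \<and> gsos_equation C B F T \<eta> \<mu> \<iota> p q l z \<zeta> \<alpha> \<and>
     (\<forall>\<alpha>'. is_algebra C F z \<alpha>' \<and> gsos_equation C B F T \<eta> \<mu> \<iota> p q l z \<zeta> \<alpha>' \<longrightarrow> \<alpha>' = \<alpha>)"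

definition dlaw_equation where
  "dlaw_equation C B G \<rho> z \<zeta> \<beta> \<longleftrightarrow>
     Cmp C \<zeta> \<beta> = Cmp C (farr B \<beta>) (Cmp C (\<rho> z) (farr G \<zeta>))"

definition dlaw_induced ::
  "('o, 'm) cat \<Rightarrow> ('o, 'm, 'o, 'm) fctr \<Rightarrow> ('o, 'm, 'o, 'm) fctr \<Rightarrow> ('o \<Rightarrow> 'm)
    \<Rightarrow> 'o \<Rightarrow> 'm \<Rightarrow> 'm \<Rightarrow> bool" where
  "dlaw_induced C B G \<rho> z \<zeta> \<beta> \<longleftrightarrow>
     is_algebra C G z \<beta> \<and> dlaw_equation C B G \<rho> z \<zeta> \<beta> \<and>
     (\<forall>\<beta>'. is_algebra C G z \<beta>' \<and> dlaw_equation C B G \<rho> z \<zeta> \<beta>' \<longrightarrow> \<beta>' = \<beta>)"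

definition definable_by_dlaw ::
  "('o, 'm) cat \<Rightarrow> ('o, 'm, 'o, 'm) fctr \<Rightarrow> ('o, 'm, 'o, 'm) fctr \<Rightarrow> 'o \<Rightarrow> 'm \<Rightarrow> 'm \<Rightarrow> bool" where
  "definable_by_dlaw C B F z \<zeta> \<alpha> \<longleftrightarrow>
     (\<exists>G \<rho> \<beta> \<kappa>. is_functor C C G \<and> is_nat C C (G \<circ>\<^sub>F B) (B \<circ>\<^sub>F G) \<rho> \<and>
        dlaw_induced C B G \<rho> z \<zeta> \<beta> \<and> is_nat C C F G \<kappa> \<and> \<alpha> = Cmp C \<beta> (\<kappa> z))"

end

theory Submission
  imports Defs
begin

text \<open>
  The functor \<open>G\<close> is the codensity monad \<open>R\<close> itself.  Since \<open>B\<close> preserves it, the family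
  \<open>\<epsilon>\<^bsub>i+1\<^esub> : R B B\<^sub>i \<rightarrow> B B\<^sub>i\<close> factors through \<open>B \<epsilon>\<close> and yields \<open>\<rho> : R B \<Rightarrow> B R\<close> with
  \<open>B \<epsilon>\<^sub>i \<circ> \<rho> = \<epsilon>\<^bsub>i+1\<^esub>\<close>; naturality of \<open>\<epsilon>\<close> at \<open>B\<^bsub>k+1,k\<^esub>\<close> then shows that \<open>\<epsilon>\<^sub>k\<close> is the algebra
  induced by \<open>\<rho>\<close>.

  A GSOS specification \<open>\<lambda>\<close> defines algebras on the whole final sequence by transfinite recursion,
  \<open>\<alpha>\<^bsub>i+1\<^esub> = B \<alpha>\<^sub>i\<^sup>* \<circ> \<lambda> \<circ> F \<langle>id, B\<^bsub>i+1,i\<^esub>\<rangle>\<close>.  They form a transformation \<open>F B\<^sub>i \<rightarrow> B\<^sub>i\<close> natural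
  in \<open>i\<close>, which corresponds to some \<open>\<kappa> : F \<Rightarrow> R\<close> with \<open>\<alpha>\<^sub>i = \<epsilon>\<^sub>i \<circ> \<kappa>\<close>.  At \<open>k\<close> the recursion
  equation becomes the GSOS equation, so \<open>\<alpha>\<^sub>k\<close> is the algebra induced by \<open>\<lambda>\<close>.  The same recursion,
  started from a coalgebra in place of \<open>\<lambda>\<close>, gives finality of \<open>B\<^sub>k\<close>.
\<close>

section \<open>Composition in a category\<close>

context category
begin

lemma Ide_simps:
  assumes "a \<in> Obj C"
  shows "Ide C a \<in> Arr C" "Dom C (Ide C a) = a" "Cod C (Ide C a) = a"
  using Ide_Hom[OF assms] by (auto simp: Hom_def)

lemma Cmp_simps:
  assumes "f \<in> Arr C" "g \<in> Arr C" "Dom C g = Cod C f"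
  shows "g \<cdot> f \<in> Arr C" "Dom C (g \<cdot> f) = Dom C f" "Cod C (g \<cdot> f) = Cod C g"
  using Cmp_Hom[of f "Dom C f" "Cod C f" g "Cod C g"] assms by (auto simp: Hom_def)

lemma Cmp_assoc_right:
  assumes "f \<in> Arr C" "g \<in> Arr C" "h \<in> Arr C" "Dom C g = Cod C f" "Dom C h = Cod C g"
  shows "(h \<cdot> g) \<cdot> f = h \<cdot> (g \<cdot> f)"
  using Cmp_assoc[of f "Dom C f" "Cod C f" g "Cod C g" h "Cod C h"] assms by (auto simp: Hom_def)

lemma Cmp_Ide:
  assumes "f \<in> Arr C"
  shows "Dom C f = a \<Longrightarrow> f \<cdot> Ide C a = f" "Cod C f = a \<Longrightarrow> Ide C a \<cdot> f = f"
  using Cmp_Ide_right[of f "Dom C f" "Cod C f"] Cmp_Ide_left[of f "Dom C f" "Cod C f"] assms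
  by (auto simp: Hom_def)

text \<open>Used as one rewrite set: brackets move to the right, identities vanish, and the
  \<open>Dom\<close>/\<open>Cod\<close> side conditions are discharged by the same rules. The
  collections \<open>typing\<close>, \<open>ty\<close> and \<open>ty'\<close> below extend it with
  the typing facts at hand.\<close>

lemmas cat_simps = Ide_simps Cmp_simps Cmp_assoc_right Cmp_Ide Dom_Obj Cod_Obj

lemma Cmp_eq_extend:
  assumes "g \<cdot> f = g' \<cdot> f'" "x \<in> Arr C" "f \<in> Arr C" "g \<in> Arr C" "f' \<in> Arr C" "g' \<in> Arr C"
    "Dom C g = Cod C f" "Dom C g' = Cod C f'" "Cod C x = Dom C f" "Cod C x = Dom C f'"
  shows "g \<cdot> (f \<cdot> x) = g' \<cdot> (f' \<cdot> x)"
  using Cmp_assoc_right[of x f g] Cmp_assoc_right[of x f' g'] assms by simp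

end

section \<open>Functors and natural transformations as rewrite rules\<close>

lemma functor_simps:
  assumes "is_functor A D F"
  shows "a \<in> Obj A \<Longrightarrow> fobj F a \<in> Obj D"
    and "f \<in> Arr A \<Longrightarrow> farr F f \<in> Arr D"
    and "f \<in> Arr A \<Longrightarrow> Dom D (farr F f) = fobj F (Dom A f)"
    and "f \<in> Arr A \<Longrightarrow> Cod D (farr F f) = fobj F (Cod A f)"
    and "a \<in> Obj A \<Longrightarrow> farr F (Ide A a) = Ide D (fobj F a)"
  using assms by (auto simp: is_functor_def Hom_def)

lemma functor_Cmp:
  assumes "is_functor A D F" "f \<in> Arr A" "g \<in> Arr A" "Dom A g = Cod A f"
  shows "farr F (Cmp A g f) = Cmp D (farr F g) (farr F f)"
  using assms by (auto simp: is_functor_def)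

lemma nat_simps:
  assumes "is_nat A D F G \<tau>" "a \<in> Obj A"
  shows "\<tau> a \<in> Arr D" "Dom D (\<tau> a) = fobj F a" "Cod D (\<tau> a) = fobj G a"
  using assms by (auto simp: is_nat_def Hom_def)

lemma nat_naturality:
  assumes "is_nat A D F G \<tau>" "f \<in> Arr A" "Dom A f = a" "Cod A f = b"
  shows "Cmp D (\<tau> b) (farr F f) = Cmp D (farr G f) (\<tau> a)"
  using assms by (auto simp: is_nat_def)

lemma comp_fctr_simps [simp]:
  "fobj (G \<circ>\<^sub>F F) a = fobj G (fobj F a)" "farr (G \<circ>\<^sub>F F) f = farr G (farr F f)"
  by (simp_all add: comp_fctr_def)

lemma id_fctr_simps [simp]: "fobj id_fctr a = a" "farr id_fctr f = f"
  by (simp_all add: id_fctr_def)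

lemma is_functor_comp:
  assumes "is_functor A D F" "is_functor D E G"
  shows "is_functor A E (G \<circ>\<^sub>F F)"
  using assms by (auto simp: is_functor_def Hom_def)

text \<open>Inverses are unique, by \<open>h = h (f g) = (h f) g = g\<close>, so the description in
  \<open>inv_arr\<close> picks the inverse.\<close>

lemma (in category) inv_arr_inverse:
  assumes "is_iso C f"
  shows "is_inverse C f (inv_arr C f)"
proof -
  obtain g where g: "is_inverse C f g" using assms by (auto simp: is_iso_def)
  have "h = g" if h: "is_inverse C f h" for h
  proof -
    have "h = h \<cdot> (f \<cdot> g)" using g h by (simp add: is_inverse_def Hom_def cat_simps)
    also have "\<dots> = (h \<cdot> f) \<cdot> g" using g h Cmp_assoc_right[of g f h] by (simp add: is_inverse_def Hom_def)
    also have "\<dots> = g" using g h by (simp add: is_inverse_def Hom_def cat_simps)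
    finally show ?thesis .
  qed
  then show ?thesis unfolding inv_arr_def using g by (metis theI')
qed

section \<open>Eilenberg--Moore extensions of algebras\<close>

locale free_monad = category C for C :: "('o, 'm) cat" (structure) +
  fixes F T :: "('o, 'm, 'o, 'm) fctr" and \<eta> \<mu> \<iota> :: "'o \<Rightarrow> 'm"
  assumes F: "is_functor C C F" and free: "is_free_monad C F T \<eta> \<mu> \<iota>"
begin

abbreviation ext :: "'o \<Rightarrow> 'm \<Rightarrow> 'm" where
  "ext x a \<equiv> EM_ext C T \<eta> \<mu> \<iota> x a"

lemma eta: "is_nat C C id_fctr T \<eta>" and mu: "is_nat C C (T \<circ>\<^sub>F T) T \<mu>"
  and iota: "is_nat C C F T \<iota>" and T: "is_functor C C T"
  using free by (auto simp: is_free_monad_def is_monad_def is_nat_def)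

lemma monad_laws:
  assumes "x \<in> Obj C"
  shows "\<mu> x \<cdot> \<eta> (fobj T x) = Ide C (fobj T x)" "\<mu> x \<cdot> farr T (\<eta> x) = Ide C (fobj T x)"
    "\<mu> x \<cdot> \<mu> (fobj T x) = \<mu> x \<cdot> farr T (\<mu> x)"
  using free assms by (auto simp: is_free_monad_def is_monad_def)

lemmas typing = cat_simps functor_simps[OF F] functor_simps[OF T] nat_simps[OF eta]
  nat_simps[OF mu] nat_simps[OF iota]

lemma free_ex1:
  assumes "is_algebra C F y a" "f \<in> Hom C x y"
  shows "\<exists>!h. h \<in> Hom C (fobj T x) y \<and> h \<cdot> \<eta> x = f
    \<and> h \<cdot> (\<mu> x \<cdot> \<iota> (fobj T x)) = a \<cdot> farr F h"
proof -
  have "x \<in> Obj C" using assms(2) by (auto simp: Hom_def typing)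
  then show ?thesis using free assms unfolding is_free_monad_def by blast
qed

text \<open>The tool for equations between maps out of \<open>T x\<close>: two
  \<open>F\<close>-algebra homomorphisms from the free algebra on \<open>x\<close> agree if they
  agree on the generators.\<close>

lemma free_unique:
  assumes "is_algebra C F y a" "f \<in> Hom C x y"
    and "h \<in> Hom C (fobj T x) y" "h \<cdot> \<eta> x = f" "h \<cdot> (\<mu> x \<cdot> \<iota> (fobj T x)) = a \<cdot> farr F h"
    and "h' \<in> Hom C (fobj T x) y" "h' \<cdot> \<eta> x = f" "h' \<cdot> (\<mu> x \<cdot> \<iota> (fobj T x)) = a \<cdot> farr F h'"
  shows "h = h'"
  using free_ex1[OF assms(1,2)] assms(3-) by blast

text \<open>The multiplication law followed by naturality of \<iota> at \<open>h\<close>: an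
  Eilenberg-Moore structure is a homomorphism from the free algebra to its own restriction along
  \<iota>.\<close>

lemma EM_algebra_free:
  assumes a: "is_algebra C F x a" and e: "is_EM_algebra C T \<eta> \<mu> x h" "h \<cdot> \<iota> x = a"
  shows "h \<cdot> (\<mu> x \<cdot> \<iota> (fobj T x)) = a \<cdot> farr F h"
proof -
  have x: "x \<in> Obj C" using a by (auto simp: is_algebra_def)
  have h: "h \<in> Arr C" "Dom C h = fobj T x" "Cod C h = x" "h \<cdot> \<mu> x = h \<cdot> farr T h"
    using e by (auto simp: is_EM_algebra_def is_algebra_def Hom_def)
  have "h \<cdot> (\<mu> x \<cdot> \<iota> (fobj T x)) = h \<cdot> (farr T h \<cdot> \<iota> (fobj T x))"
    by (rule Cmp_eq_extend[OF h(4)]) (simp_all add: typing h x)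
  also have "farr T h \<cdot> \<iota> (fobj T x) = \<iota> x \<cdot> farr F h"
    using nat_naturality[OF iota] h by simp
  also have "h \<cdot> (\<iota> x \<cdot> farr F h) = (h \<cdot> \<iota> x) \<cdot> farr F h"
    by (simp add: typing h x)
  finally show ?thesis using e by simp
qed

text \<open>The structure is the homomorphic extension of \<open>Ide C x\<close> to the free
  algebra. Uniqueness holds because, by \<open>EM_algebra_free\<close>, every candidate is such an
  extension. This makes the description in \<open>EM_ext\<close> meaningful.\<close>

lemma EM_algebra_ex1:
  assumes a: "is_algebra C F x a"
  shows "\<exists>!h. is_EM_algebra C T \<eta> \<mu> x h \<and> h \<cdot> \<iota> x = a"
proof -
  have x: "x \<in> Obj C" and a': "a \<in> Arr C" "Dom C a = fobj F x" "Cod C a = x"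
    using a by (auto simp: is_algebra_def Hom_def)
  obtain h where h: "h \<in> Hom C (fobj T x) x" and he: "h \<cdot> \<eta> x = Ide C x"
    and hm: "h \<cdot> (\<mu> x \<cdot> \<iota> (fobj T x)) = a \<cdot> farr F h"
    using free_ex1[OF a Ide_Hom[OF x]] by blast
  have h': "h \<in> Arr C" "Dom C h = fobj T x" "Cod C h = x" using h by (auto simp: Hom_def)
  note ty = typing x a' h'
  \<comment> \<open>Inserting \<open>F (h \<eta>) = id\<close> creates the composite
    \<open>a \<cdot> farr F h\<close>, to which the homomorphism law \<open>hm\<close> applies
    backwards.\<close>
  have "a = a \<cdot> (farr F h \<cdot> farr F (\<eta> x))"
    using functor_Cmp[OF F, of "\<eta> x" h, symmetric] by (simp add: ty he)
  also have "\<dots> = (h \<cdot> (\<mu> x \<cdot> \<iota> (fobj T x))) \<cdot> farr F (\<eta> x)"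
    unfolding hm by (simp add: ty)
  also have "\<dots> = h \<cdot> (\<mu> x \<cdot> (\<iota> (fobj T x) \<cdot> farr F (\<eta> x)))"
    by (simp add: ty)
  also have "\<iota> (fobj T x) \<cdot> farr F (\<eta> x) = farr T (\<eta> x) \<cdot> \<iota> x"
    by (rule nat_naturality[OF iota]) (simp_all add: ty)
  also have "\<mu> x \<cdot> (farr T (\<eta> x) \<cdot> \<iota> x) = (\<mu> x \<cdot> farr T (\<eta> x)) \<cdot> \<iota> x"
    by (simp add: ty)
  also have "\<dots> = \<iota> x"
    unfolding monad_laws(2)[OF x] by (simp add: ty)
  finally have hi: "h \<cdot> \<iota> x = a" by simp
  \<comment> \<open>Both sides are homomorphisms into \<open>a\<close> from the free algebra on
    \<open>T x\<close>, and both restrict to \<open>h\<close> along \<eta>.\<close>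
  have "h \<cdot> \<mu> x = h \<cdot> farr T h"
  proof (rule free_unique[OF a h])
    have "(h \<cdot> \<mu> x) \<cdot> \<eta> (fobj T x) = h \<cdot> (\<mu> x \<cdot> \<eta> (fobj T x))" by (simp add: ty)
    then show "(h \<cdot> \<mu> x) \<cdot> \<eta> (fobj T x) = h" by (simp add: monad_laws ty)
    have "(h \<cdot> farr T h) \<cdot> \<eta> (fobj T x) = h \<cdot> (farr T h \<cdot> \<eta> (fobj T x))" by (simp add: ty)
    also have "farr T h \<cdot> \<eta> (fobj T x) = \<eta> x \<cdot> h"
      using nat_naturality[OF eta] h' by simp
    also have "h \<cdot> (\<eta> x \<cdot> h) = (h \<cdot> \<eta> x) \<cdot> h" by (simp add: ty)
    finally show "(h \<cdot> farr T h) \<cdot> \<eta> (fobj T x) = h" unfolding he by (simp add: ty)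
    have "(h \<cdot> \<mu> x) \<cdot> (\<mu> (fobj T x) \<cdot> \<iota> (fobj T (fobj T x)))
        = h \<cdot> (\<mu> x \<cdot> (\<mu> (fobj T x) \<cdot> \<iota> (fobj T (fobj T x))))"
      by (simp add: ty)
    also have "\<mu> x \<cdot> (\<mu> (fobj T x) \<cdot> \<iota> (fobj T (fobj T x)))
        = \<mu> x \<cdot> (farr T (\<mu> x) \<cdot> \<iota> (fobj T (fobj T x)))"
      by (rule Cmp_eq_extend[OF monad_laws(3)[OF x]]) (simp_all add: ty)
    also have "farr T (\<mu> x) \<cdot> \<iota> (fobj T (fobj T x)) = \<iota> (fobj T x) \<cdot> farr F (\<mu> x)"
      by (rule nat_naturality[OF iota, symmetric]) (simp_all add: ty)
    also have "h \<cdot> (\<mu> x \<cdot> (\<iota> (fobj T x) \<cdot> farr F (\<mu> x)))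
        = (h \<cdot> (\<mu> x \<cdot> \<iota> (fobj T x))) \<cdot> farr F (\<mu> x)" by (simp add: ty)
    also have "\<dots> = a \<cdot> farr F (h \<cdot> \<mu> x)"
      unfolding hm by (simp add: ty functor_Cmp[OF F])
    finally show "(h \<cdot> \<mu> x) \<cdot> (\<mu> (fobj T x) \<cdot> \<iota> (fobj T (fobj T x))) = a \<cdot> farr F (h \<cdot> \<mu> x)" .
    have "(h \<cdot> farr T h) \<cdot> (\<mu> (fobj T x) \<cdot> \<iota> (fobj T (fobj T x)))
        = h \<cdot> (farr T h \<cdot> (\<mu> (fobj T x) \<cdot> \<iota> (fobj T (fobj T x))))" by (simp add: ty)
    also have "farr T h \<cdot> (\<mu> (fobj T x) \<cdot> \<iota> (fobj T (fobj T x)))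
        = \<mu> x \<cdot> (farr T (farr T h) \<cdot> \<iota> (fobj T (fobj T x)))"
      by (rule Cmp_eq_extend[OF nat_naturality[OF mu, symmetric, of h, simplified]])
        (simp_all add: ty)
    also have "farr T (farr T h) \<cdot> \<iota> (fobj T (fobj T x)) = \<iota> (fobj T x) \<cdot> farr F (farr T h)"
      by (rule nat_naturality[OF iota, symmetric]) (simp_all add: ty)
    also have "h \<cdot> (\<mu> x \<cdot> (\<iota> (fobj T x) \<cdot> farr F (farr T h)))
        = (h \<cdot> (\<mu> x \<cdot> \<iota> (fobj T x))) \<cdot> farr F (farr T h)" by (simp add: ty)
    also have "\<dots> = a \<cdot> farr F (h \<cdot> farr T h)"
      unfolding hm by (simp add: ty functor_Cmp[OF F])
    finally show "(h \<cdot> farr T h) \<cdot> (\<mu> (fobj T x) \<cdot> \<iota> (fobj T (fobj T x)))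
      = a \<cdot> farr F (h \<cdot> farr T h)" .
  qed (simp_all add: Hom_def ty)
  then have em: "is_EM_algebra C T \<eta> \<mu> x h"
    using h he x by (simp add: is_EM_algebra_def is_algebra_def)
  show ?thesis
  proof (rule ex1I[of _ h])
    show "is_EM_algebra C T \<eta> \<mu> x h \<and> h \<cdot> \<iota> x = a" using em hi by simp
    fix g assume g: "is_EM_algebra C T \<eta> \<mu> x g \<and> g \<cdot> \<iota> x = a"
    show "g = h"
      using free_unique[OF a Ide_Hom[OF x] _ _ EM_algebra_free[OF a] h he hm] g
      by (auto simp: is_EM_algebra_def is_algebra_def)
  qed
qed

text \<open>From here on \<open>ext x a\<close> is used only as the homomorphism from the free
  algebra on \<open>x\<close> to \<open>a\<close> that extends the identity.\<close>

lemma ext_props: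
  assumes "is_algebra C F x a"
  shows "ext x a \<in> Hom C (fobj T x) x" "ext x a \<cdot> \<eta> x = Ide C x"
    "ext x a \<cdot> (\<mu> x \<cdot> \<iota> (fobj T x)) = a \<cdot> farr F (ext x a)"
proof -
  have *: "is_EM_algebra C T \<eta> \<mu> x (ext x a) \<and> ext x a \<cdot> \<iota> x = a"
    unfolding EM_ext_def by (rule theI'[OF EM_algebra_ex1[OF assms]])
  then show "ext x a \<in> Hom C (fobj T x) x" "ext x a \<cdot> \<eta> x = Ide C x"
    by (auto simp: is_EM_algebra_def is_algebra_def)
  show "ext x a \<cdot> (\<mu> x \<cdot> \<iota> (fobj T x)) = a \<cdot> farr F (ext x a)"
    using EM_algebra_free[OF assms] * by blast
qed

text \<open>Both sides are homomorphisms from the free algebra on \<open>x\<close> to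
  \<open>b\<close> that extend \<open>f\<close>. Thus a morphism of \<open>F\<close>-algebras is
  also one of the corresponding Eilenberg-Moore algebras.\<close>

lemma ext_hom:
  assumes a: "is_algebra C F x a" and b: "is_algebra C F y b" and f: "f \<in> Hom C x y"
    and fa: "f \<cdot> a = b \<cdot> farr F f"
  shows "f \<cdot> ext x a = ext y b \<cdot> farr T f"
proof -
  have x: "x \<in> Obj C" "y \<in> Obj C" and a': "a \<in> Arr C" "Dom C a = fobj F x" "Cod C a = x"
    and b': "b \<in> Arr C" "Dom C b = fobj F y" "Cod C b = y"
    and f': "f \<in> Arr C" "Dom C f = x" "Cod C f = y"
    using a b f by (auto simp: is_algebra_def Hom_def)
  have e: "ext x a \<in> Arr C" "Dom C (ext x a) = fobj T x" "Cod C (ext x a) = x"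
    "ext y b \<in> Arr C" "Dom C (ext y b) = fobj T y" "Cod C (ext y b) = y"
    using ext_props(1)[OF a] ext_props(1)[OF b] by (auto simp: Hom_def)
  note ty = typing x a' b' f' e
  show ?thesis
  proof (rule free_unique[OF b f])
    show "(f \<cdot> ext x a) \<cdot> \<eta> x = f" by (simp add: ty ext_props(2)[OF a])
    have "(ext y b \<cdot> farr T f) \<cdot> \<eta> x = ext y b \<cdot> (farr T f \<cdot> \<eta> x)" by (simp add: ty)
    also have "farr T f \<cdot> \<eta> x = \<eta> y \<cdot> f"
      using nat_naturality[OF eta] f' by simp
    also have "ext y b \<cdot> (\<eta> y \<cdot> f) = (ext y b \<cdot> \<eta> y) \<cdot> f" by (simp add: ty)
    finally show "(ext y b \<cdot> farr T f) \<cdot> \<eta> x = f"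
      unfolding ext_props(2)[OF b] by (simp add: ty)
    have "(f \<cdot> ext x a) \<cdot> (\<mu> x \<cdot> \<iota> (fobj T x)) = f \<cdot> (a \<cdot> farr F (ext x a))"
      by (simp add: ty ext_props(3)[OF a])
    also have "\<dots> = b \<cdot> (farr F f \<cdot> farr F (ext x a))"
      by (rule Cmp_eq_extend[OF fa]) (simp_all add: ty)
    finally show "(f \<cdot> ext x a) \<cdot> (\<mu> x \<cdot> \<iota> (fobj T x)) = b \<cdot> farr F (f \<cdot> ext x a)"
      by (simp add: ty functor_Cmp[OF F])
    have "(ext y b \<cdot> farr T f) \<cdot> (\<mu> x \<cdot> \<iota> (fobj T x))
        = ext y b \<cdot> (farr T f \<cdot> (\<mu> x \<cdot> \<iota> (fobj T x)))" by (simp add: ty)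
    also have "farr T f \<cdot> (\<mu> x \<cdot> \<iota> (fobj T x))
        = \<mu> y \<cdot> (farr T (farr T f) \<cdot> \<iota> (fobj T x))"
      by (rule Cmp_eq_extend[OF nat_naturality[OF mu, symmetric, of f, simplified]])
        (simp_all add: ty)
    also have "farr T (farr T f) \<cdot> \<iota> (fobj T x) = \<iota> (fobj T y) \<cdot> farr F (farr T f)"
      by (rule nat_naturality[OF iota, symmetric]) (simp_all add: ty)
    also have "ext y b \<cdot> (\<mu> y \<cdot> (\<iota> (fobj T y) \<cdot> farr F (farr T f)))
        = (ext y b \<cdot> (\<mu> y \<cdot> \<iota> (fobj T y))) \<cdot> farr F (farr T f)" by (simp add: ty)
    also have "\<dots> = b \<cdot> farr F (ext y b \<cdot> farr T f)"
      unfolding ext_props(3)[OF b] by (simp add: ty functor_Cmp[OF F])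
    finally show "(ext y b \<cdot> farr T f) \<cdot> (\<mu> x \<cdot> \<iota> (fobj T x)) = b \<cdot> farr F (ext y b \<cdot> farr T f)" .
  qed (simp_all add: Hom_def ty)
qed

end

section \<open>Recursion along the final sequence\<close>

lemma Ord_op_simps [simp]:
  "Obj (Ord_op r) = Field r" "Arr (Ord_op r) = r" "Dom (Ord_op r) = snd" "Cod (Ord_op r) = fst"
  "Ide (Ord_op r) i = (i, i)" "Cmp (Ord_op r) g f = (fst g, snd f)"
  by (simp_all add: opposite_def order_cat_def)

section \<open>Order and successor of small ordinals\<close>

locale ordinals =
  fixes \<Omega> :: "'u rel"
  assumes universe: "universe_size \<Omega>"
begin

abbreviation suc :: "'u \<Rightarrow> 'u" where
  "suc i \<equiv> ord_suc \<Omega> i"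

lemma wo_rel: "wo_rel \<Omega>"
  using universe by (simp add: universe_size_def wo_rel_def card_order_on_def)

lemma le_Field: "(i, j) \<in> \<Omega> \<Longrightarrow> i \<in> Field \<Omega>" "(i, j) \<in> \<Omega> \<Longrightarrow> j \<in> Field \<Omega>"
  by (auto simp: Field_def)

lemma le_refl: "i \<in> Field \<Omega> \<Longrightarrow> (i, i) \<in> \<Omega>"
  using wo_rel.REFL[OF wo_rel] by (auto simp: refl_on_def)

lemma le_trans: "(i, j) \<in> \<Omega> \<Longrightarrow> (j, l) \<in> \<Omega> \<Longrightarrow> (i, l) \<in> \<Omega>"
  using wo_rel.TRANS[OF wo_rel] by (auto simp: trans_def)

lemma le_antisym: "(i, j) \<in> \<Omega> \<Longrightarrow> (j, i) \<in> \<Omega> \<Longrightarrow> i = j"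
  using wo_rel.ANTISYM[OF wo_rel] by (auto simp: antisym_def)

lemma le_linear: "i \<in> Field \<Omega> \<Longrightarrow> j \<in> Field \<Omega> \<Longrightarrow> (i, j) \<in> \<Omega> \<or> (j, i) \<in> \<Omega>"
  using wo_rel.TOTALS[OF wo_rel] by blast

text \<open>An infinite cardinal is a limit ordinal and has no greatest element; hence
  \<open>suc\<close> is a genuine successor everywhere on the field.\<close>

lemma AboveS_singleton:
  assumes "i \<in> Field \<Omega>"
  shows "AboveS \<Omega> {i} \<noteq> {}"
proof -
  obtain b where "b \<in> Field \<Omega>" "i \<noteq> b" "(i, b) \<in> \<Omega>"
    using universe assms infinite_Card_order_limit[of \<Omega> i]
    by (auto simp: universe_size_def cinfinite_def)
  then show ?thesis by (auto simp: AboveS_def)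
qed

lemma suc_greater:
  assumes "i \<in> Field \<Omega>"
  shows "suc i \<noteq> i" "(i, suc i) \<in> \<Omega>" "suc i \<in> Field \<Omega>"
  using wo_rel.suc_greater[OF wo_rel _ AboveS_singleton[OF assms], of i] assms
  by (auto simp: ord_suc_def Field_def)

lemma suc_least: "(i, j) \<in> \<Omega> \<Longrightarrow> i \<noteq> j \<Longrightarrow> (suc i, j) \<in> \<Omega>"
  unfolding ord_suc_def
  by (rule wo_rel.suc_least_AboveS[OF wo_rel]) (auto simp: AboveS_def Field_def)

lemma le_suc:
  assumes "(i, suc j) \<in> \<Omega>" "i \<noteq> suc j" "j \<in> Field \<Omega>"
  shows "(i, j) \<in> \<Omega>"
  using assms le_linear[of i j] le_refl suc_least[of j i] le_antisym le_Field(1) by metis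

lemma suc_mono:
  assumes "(i, j) \<in> \<Omega>"
  shows "(suc i, suc j) \<in> \<Omega>"
  using assms suc_greater suc_least le_trans le_antisym le_Field by metis

lemma suc_inj:
  assumes "suc i = suc j" "i \<in> Field \<Omega>" "j \<in> Field \<Omega>"
  shows "i = j"
  using assms suc_greater le_suc le_antisym by metis

lemma ord_cases:
  assumes "j \<in> Field \<Omega>"
  obtains (zero) "ord_zero \<Omega> j" | (suc) i where "i \<in> Field \<Omega>" "j = suc i" | (limit) "ord_limit \<Omega> j"
  using assms by (auto simp: ord_limit_def)

lemma wf_less: "wf (\<Omega> - Id)"
  by (rule wo_rel.WF[OF wo_rel])

end

section \<open>The final sequence and recursion along it\<close>

locale final_sequence = category C + ordinals \<Omega>
  for C :: "('o, 'm) cat" (structure) and \<Omega> :: "'u rel" +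
  fixes B :: "('o, 'm, 'o, 'm) fctr" and S :: "('u, 'u \<times> 'u, 'o, 'm) fctr"
  assumes B: "is_functor C C B" and final_seq: "is_final_sequence \<Omega> C B S"
begin

lemma S: "is_functor (Ord_op \<Omega>) C S"
  using final_seq by (simp add: is_final_sequence_def)

lemma S_zero: "ord_zero \<Omega> i \<Longrightarrow> is_terminal C (fobj S i)"
  using final_seq by (simp add: is_final_sequence_def)

lemma S_suc: "i \<in> Field \<Omega> \<Longrightarrow> fobj S (suc i) = fobj B (fobj S i)"
  using final_seq by (simp add: is_final_sequence_def)

lemma conn_suc: "(i, j) \<in> \<Omega> \<Longrightarrow> conn S (suc j) (suc i) = farr B (conn S j i)"
  using final_seq by (simp add: is_final_sequence_def)

text \<open>Reflexivity keeps each ordinal below \<open>j\<close> in the field of the restricted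
  order, so a cone in the limit clause has a leg for each of them.\<close>

lemma Field_below_limit: "Field (Restr \<Omega> (underS \<Omega> j)) = underS \<Omega> j"
  using le_refl by (auto simp: underS_def Field_def)

lemma S_limit_ex1:
  assumes j: "ord_limit \<Omega> j" and x: "x \<in> Obj C"
    and \<xi>: "\<And>i. i \<in> underS \<Omega> j \<Longrightarrow> \<xi> i \<in> Hom C x (fobj S i)"
    and c: "\<And>i i'. i \<in> underS \<Omega> j \<Longrightarrow> i' \<in> underS \<Omega> j \<Longrightarrow> (i, i') \<in> \<Omega> \<Longrightarrow> conn S i' i \<cdot> \<xi> i' = \<xi> i"
  shows "\<exists>!h. h \<in> Hom C x (fobj S j) \<and> (\<forall>i \<in> underS \<Omega> j. conn S j i \<cdot> h = \<xi> i)"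
proof -
  have lim: "is_limit (Ord_op (Restr \<Omega> (underS \<Omega> j))) C S (fobj S j) (\<lambda>i. conn S j i)"
    using final_seq j by (simp add: is_final_sequence_def)
  have "is_cone (Ord_op (Restr \<Omega> (underS \<Omega> j))) C S x \<xi>"
    using x \<xi> c by (auto simp: is_cone_def Field_below_limit)
  then show ?thesis
    using lim by (simp add: is_limit_def Field_below_limit)
qed

lemma conn_simps:
  assumes "is_functor (Ord_op \<Omega>) C H" "(i, j) \<in> \<Omega>"
  shows "conn H j i \<in> Arr C" "Dom C (conn H j i) = fobj H j" "Cod C (conn H j i) = fobj H i"
  using functor_simps(2-4)[OF assms(1), of "(i, j)"] assms(2) by simp_all

lemma conn_Cmp:
  assumes "is_functor (Ord_op \<Omega>) C H" "(i, j) \<in> \<Omega>" "(j, l) \<in> \<Omega>"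
  shows "conn H j i \<cdot> conn H l j = conn H l i"
  using functor_Cmp[OF assms(1), of "(j, l)" "(i, j)"] assms(2,3) by simp

lemma conn_refl:
  assumes "is_functor (Ord_op \<Omega>) C H" "i \<in> Field \<Omega>"
  shows "conn H i i = Ide C (fobj H i)"
  using functor_simps(5)[OF assms(1), of i] assms(2) by simp

lemma fobj_Obj: "is_functor (Ord_op \<Omega>) C H \<Longrightarrow> i \<in> Field \<Omega> \<Longrightarrow> fobj H i \<in> Obj C"
  using functor_simps(1)[of "Ord_op \<Omega>" C H i] by simp

lemma terminal_eq:
  "ord_zero \<Omega> i \<Longrightarrow> f \<in> Hom C x (fobj S i) \<Longrightarrow> g \<in> Hom C x (fobj S i) \<Longrightarrow> f = g"
  using S_zero[of i] unfolding is_terminal_def Hom_def by (auto dest: Dom_Obj)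

text \<open>The composites of \<open>f\<close> with the projections form a cone, and both
  \<open>f\<close> and \<open>g\<close> mediate it.\<close>

lemma limit_eq:
  assumes j: "ord_limit \<Omega> j" and f: "f \<in> Hom C x (fobj S j)" and g: "g \<in> Hom C x (fobj S j)"
    and eq: "\<And>i. i \<in> underS \<Omega> j \<Longrightarrow> conn S j i \<cdot> f = conn S j i \<cdot> g"
  shows "f = g"
proof -
  have f': "f \<in> Arr C" "Dom C f = x" "Cod C f = fobj S j" using f by (auto simp: Hom_def)
  have "\<exists>!h. h \<in> Hom C x (fobj S j) \<and> (\<forall>i \<in> underS \<Omega> j. conn S j i \<cdot> h = conn S j i \<cdot> f)"
  proof (rule S_limit_ex1[OF j])
    show "x \<in> Obj C" using f' by (auto dest: Dom_Obj)
    show "conn S j i \<cdot> f \<in> Hom C x (fobj S i)" if "i \<in> underS \<Omega> j" for i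
      using that by (auto simp: underS_def Hom_def cat_simps conn_simps[OF S] f')
    show "conn S i' i \<cdot> (conn S j i' \<cdot> f) = conn S j i \<cdot> f"
      if "i \<in> underS \<Omega> j" "i' \<in> underS \<Omega> j" "(i, i') \<in> \<Omega>" for i i'
      using that Cmp_assoc_right[of f "conn S j i'" "conn S i' i"]
      by (auto simp: underS_def cat_simps conn_simps[OF S] f' conn_Cmp[OF S])
  qed
  then show ?thesis using f g eq by metis
qed

text \<open>Only the successor stages need data: maps into the terminal object and into limits are
  forced. Compatibility of \<open>step\<close> is required only for pairs that are already
  compatible, which is what the induction can provide. The domain \<open>H\<close> is arbitrary so
  that a constant diagram (for finality) and \<open>F \<circ>\<^sub>F S\<close> (for GSOS) are both
  covered.\<close>

lemma nat_by_recursion: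
  fixes H :: "('u, 'u \<times> 'u, 'o, 'm) fctr" and step :: "'u \<Rightarrow> 'm \<Rightarrow> 'm"
  assumes H: "is_functor (Ord_op \<Omega>) C H"
    and step: "\<And>i f. i \<in> Field \<Omega> \<Longrightarrow> f \<in> Hom C (fobj H i) (fobj S i)
      \<Longrightarrow> step i f \<in> Hom C (fobj H (suc i)) (fobj S (suc i))"
    and step_nat: "\<And>i j f g. (i, j) \<in> \<Omega> \<Longrightarrow> f \<in> Hom C (fobj H i) (fobj S i)
      \<Longrightarrow> g \<in> Hom C (fobj H j) (fobj S j) \<Longrightarrow> conn S j i \<cdot> g = f \<cdot> conn H j i
      \<Longrightarrow> conn S (suc j) (suc i) \<cdot> step j g = step i f \<cdot> conn H (suc j) (suc i)"
  obtains \<tau> where "is_nat (Ord_op \<Omega>) C H S \<tau>" "\<And>i. i \<in> Field \<Omega> \<Longrightarrow> \<tau> (suc i) = step i (\<tau> i)"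
proof -
  \<comment> \<open>The three cases yield a map into the terminal object, \<open>step\<close> at the
    predecessor recovered from \<open>suc i\<close>, and the mediating map of a limit. That these
    descriptions denote is shown only later.\<close>
  define \<Phi> where "\<Phi> \<tau> j = (if ord_zero \<Omega> j then SOME f. f \<in> Hom C (fobj H j) (fobj S j)
    else if \<exists>i \<in> Field \<Omega>. j = suc i
      then let i = (THE i. i \<in> Field \<Omega> \<and> j = suc i) in step i (\<tau> i)
    else THE h. h \<in> Hom C (fobj H j) (fobj S j)
      \<and> (\<forall>i \<in> underS \<Omega> j. conn S j i \<cdot> h = \<tau> i \<cdot> conn H j i))" for \<tau> j
  define \<tau> where "\<tau> = wfrec (\<Omega> - Id) \<Phi>"
  have rec: "\<tau> j = \<Phi> (cut \<tau> (\<Omega> - Id) j) j" for j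
    unfolding \<tau>_def by (rule wfrec[OF wf_less])
  have cut_less: "cut \<tau> (\<Omega> - Id) j i = \<tau> i" if "i \<in> underS \<Omega> j" for i j
    using that by (intro cut_apply) (auto simp: underS_def)
  have \<tau>_zero: "\<tau> j = (SOME f. f \<in> Hom C (fobj H j) (fobj S j))" if "ord_zero \<Omega> j" for j
    using that rec[of j] by (simp add: \<Phi>_def)
  have \<tau>_suc: "\<tau> (suc i) = step i (\<tau> i)" if i: "i \<in> Field \<Omega>" for i
  proof -
    have u: "i \<in> underS \<Omega> (suc i)" using suc_greater[OF i] by (auto simp: underS_def)
    then have "\<not> ord_zero \<Omega> (suc i)" by (auto simp: ord_zero_def)
    moreover have "(THE i'. i' \<in> Field \<Omega> \<and> suc i = suc i') = i"
      using i suc_inj by (intro the_equality) auto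
    ultimately show ?thesis
      using i rec[of "suc i"] cut_less[OF u] by (auto simp: \<Phi>_def)
  qed
  have \<tau>_limit: "\<tau> j = (THE h. h \<in> Hom C (fobj H j) (fobj S j)
      \<and> (\<forall>i \<in> underS \<Omega> j. conn S j i \<cdot> h = \<tau> i \<cdot> conn H j i))" if "ord_limit \<Omega> j" for j
    \<comment> \<open>The congruence rules supply \<open>i \<in> underS \<Omega> j\<close>, under
      which \<open>cut_less\<close> removes the cut.\<close>
    using that rec[of j] by (auto simp: \<Phi>_def ord_limit_def cut_less cong: conj_cong ball_cong)
  \<comment> \<open>Typing and naturality must be proved together: at a limit the earlier components
    form a cone only because they are natural among themselves.\<close>
  have good: "\<tau> j \<in> Hom C (fobj H j) (fobj S j)
    \<and> (\<forall>i. (i, j) \<in> \<Omega> \<longrightarrow> conn S j i \<cdot> \<tau> j = \<tau> i \<cdot> conn H j i)" if "j \<in> Field \<Omega>" for j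
    using that
  proof (induction j rule: wf_induct_rule[OF wf_less])
    case (1 j)
    have Hj: "fobj H j \<in> Obj C" by (rule fobj_Obj[OF H 1(2)])
    have IHt: "\<tau> i \<in> Arr C" "Dom C (\<tau> i) = fobj H i" "Cod C (\<tau> i) = fobj S i"
      if "i \<in> underS \<Omega> j" for i
      using 1(1)[of i] that le_Field by (auto simp: underS_def Hom_def)
    have IHn: "conn S i i' \<cdot> \<tau> i = \<tau> i' \<cdot> conn H i i'" if "i \<in> underS \<Omega> j" "(i', i) \<in> \<Omega>" for i i'
      using 1(1)[of i] that le_Field by (auto simp: underS_def)
    have refl_case: "conn S j j \<cdot> \<tau> j = \<tau> j \<cdot> conn H j j" if "\<tau> j \<in> Hom C (fobj H j) (fobj S j)"
      using that 1(2) by (auto simp: conn_refl[OF S] conn_refl[OF H] Hom_def cat_simps)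
    show ?case using 1(2)
    proof (cases rule: ord_cases)
      case zero
      have t: "\<tau> j \<in> Hom C (fobj H j) (fobj S j)"
        unfolding \<tau>_zero[OF zero] by (rule someI_ex) (use S_zero[OF zero] Hj in \<open>auto simp: is_terminal_def\<close>)
      have "i = j" if "(i, j) \<in> \<Omega>" for i
        using zero that by (auto simp: ord_zero_def underS_def)
      then show ?thesis using t refl_case by blast
    next
      case limit
      have ex1: "\<exists>!h. h \<in> Hom C (fobj H j) (fobj S j)
          \<and> (\<forall>i \<in> underS \<Omega> j. conn S j i \<cdot> h = \<tau> i \<cdot> conn H j i)"
      proof (rule S_limit_ex1[OF limit Hj])
        show "\<tau> i \<cdot> conn H j i \<in> Hom C (fobj H j) (fobj S i)" if "i \<in> underS \<Omega> j" for i
          using that IHt[OF that] by (auto simp: underS_def Hom_def cat_simps conn_simps[OF H])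
        show "conn S i' i \<cdot> (\<tau> i' \<cdot> conn H j i') = \<tau> i \<cdot> conn H j i"
          if i: "i \<in> underS \<Omega> j" "i' \<in> underS \<Omega> j" "(i, i') \<in> \<Omega>" for i i'
        proof -
          have "(i', j) \<in> \<Omega>" using i by (simp add: underS_def)
          then have "conn S i' i \<cdot> (\<tau> i' \<cdot> conn H j i') = \<tau> i \<cdot> (conn H i' i \<cdot> conn H j i')"
            using i by (intro Cmp_eq_extend[OF IHn]) (simp_all add: IHt conn_simps[OF H] conn_simps[OF S])
          then show ?thesis using conn_Cmp[OF H i(3) \<open>(i', j) \<in> \<Omega>\<close>] by simp
        qed
      qed
      have "\<tau> j \<in> Hom C (fobj H j) (fobj S j)
          \<and> (\<forall>i \<in> underS \<Omega> j. conn S j i \<cdot> \<tau> j = \<tau> i \<cdot> conn H j i)"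
        unfolding \<tau>_limit[OF limit] by (rule theI'[OF ex1])
      then show ?thesis using refl_case by (auto simp: underS_def)
    next
      case (suc l)
      have lj: "l \<in> underS \<Omega> j" using suc suc_greater[of l] by (simp add: underS_def)
      have t: "\<tau> j \<in> Hom C (fobj H j) (fobj S j)"
        using step[of l "\<tau> l"] suc \<tau>_suc[of l] IHt[OF lj] by (simp add: Hom_def)
      then have t': "\<tau> j \<in> Arr C" "Dom C (\<tau> j) = fobj H j" "Cod C (\<tau> j) = fobj S j"
        by (auto simp: Hom_def)
      \<comment> \<open>Naturality at a successor needs a second induction, on \<open>i\<close>: a limit \<open>i\<close> below \<open>j\<close> is reached
        only through the projections of its limit cone.\<close>
      have "conn S j i \<cdot> \<tau> j = \<tau> i \<cdot> conn H j i" if "(i, j) \<in> \<Omega>" for i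
        using that
      proof (induction i rule: wf_induct_rule[OF wf_less])
        case (1 i)
        show ?case
        proof (cases "i = j")
          case True
          then show ?thesis using refl_case t by simp
        next
          case False
          have ij: "i \<in> underS \<Omega> j" using False 1 by (simp add: underS_def)
          have ty: "conn S j i \<cdot> \<tau> j \<in> Hom C (fobj H j) (fobj S i)"
            "\<tau> i \<cdot> conn H j i \<in> Hom C (fobj H j) (fobj S i)"
            using 1(2) t' IHt[OF ij] by (auto simp: Hom_def cat_simps conn_simps[OF S] conn_simps[OF H])
          show ?thesis using le_Field(1)[OF 1(2)]
          proof (cases rule: ord_cases)
            case zero
            show ?thesis by (rule terminal_eq[OF zero ty])
          next
            case (suc m)
            have "m \<in> Field \<Omega>" "(m, i) \<in> \<Omega>" using suc suc_greater[of m] by auto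
            \<comment> \<open>Since \<open>i = suc m\<close> lies strictly below
              \<open>j = suc l\<close>, also \<open>m\<close> is at most \<open>l\<close>. The outer
              hypothesis at \<open>l\<close> then gives the square for \<open>(m, l)\<close> that
              \<open>step_nat\<close> asks for.\<close>
            moreover have "(suc m, l) \<in> \<Omega>"
              using le_suc[of "suc m" l] 1(2) False suc \<open>j = suc l\<close> \<open>l \<in> Field \<Omega>\<close> by simp
            ultimately have ml: "(m, l) \<in> \<Omega>" using le_trans suc by blast
            have mj: "m \<in> underS \<Omega> j"
              using \<open>(m, i) \<in> \<Omega>\<close> ij le_trans le_antisym by (auto simp: underS_def)
            show ?thesis
              using step_nat[OF ml _ _ IHn[OF lj ml]] IHt[OF lj] IHt[OF mj] suc \<open>j = suc l\<close>
                \<tau>_suc[of l] \<tau>_suc[of m] \<open>l \<in> Field \<Omega>\<close> by (simp add: Hom_def)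
          next
            case limit
            show ?thesis
            proof (rule limit_eq[OF limit ty])
              fix n assume n: "n \<in> underS \<Omega> i"
              then have ni: "(n, i) \<in> \<Omega>" "n \<noteq> i" by (auto simp: underS_def)
              have nj: "(n, j) \<in> \<Omega>" using le_trans ni 1(2) by blast
              have nj': "n \<in> underS \<Omega> j"
                using ni ij nj le_antisym by (auto simp: underS_def)
              have "conn S i n \<cdot> (conn S j i \<cdot> \<tau> j) = (conn S i n \<cdot> conn S j i) \<cdot> \<tau> j"
                using ni 1(2) t' by (simp add: cat_simps conn_simps[OF S])
              also have "\<dots> = conn S j n \<cdot> \<tau> j"
                by (simp add: conn_Cmp[OF S ni(1) 1(2)])
              \<comment> \<open>This is the inner hypothesis, at \<open>n\<close> below
                \<open>i\<close>; the outer one, at \<open>i\<close> below \<open>j\<close>, is used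
                two steps further on.\<close>
              also have "\<dots> = \<tau> n \<cdot> conn H j n" using 1(1)[of n] ni nj by simp
              also have "\<dots> = \<tau> n \<cdot> (conn H i n \<cdot> conn H j i)"
                by (simp add: conn_Cmp[OF H ni(1) 1(2)])
              also have "\<dots> = conn S i n \<cdot> (\<tau> i \<cdot> conn H j i)"
                using ni 1(2)
                by (intro Cmp_eq_extend[OF IHn[OF ij ni(1), symmetric]])
                  (simp_all add: IHt[OF ij] IHt[OF nj'] conn_simps[OF H] conn_simps[OF S])
              finally show "conn S i n \<cdot> (conn S j i \<cdot> \<tau> j) = conn S i n \<cdot> (\<tau> i \<cdot> conn H j i)" .
            qed
          qed
        qed
      qed
      then show ?thesis using t by blast
    qed
  qed
  have "is_nat (Ord_op \<Omega>) C H S \<tau>"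
    using H S good le_Field by (auto simp: is_nat_def)
  then show thesis using that \<tau>_suc by blast
qed

end

section \<open>A final sequence that stabilises at \<open>k\<close>, and its final coalgebra\<close>

locale stable_final_sequence = final_sequence C \<Omega> B S
  for C :: "('o, 'm) cat" (structure) and \<Omega> :: "'u rel" and B S +
  fixes k :: 'u
  assumes k: "k \<in> Field \<Omega>" and iso: "is_iso C (conn S (ord_suc \<Omega> k) k)"
begin

abbreviation "Z \<equiv> fobj S k"
abbreviation "\<zeta> \<equiv> inv_arr C (conn S (suc k) k)"

lemma Z_Obj: "Z \<in> Obj C"
  by (rule fobj_Obj[OF S k])

lemma zeta: "\<zeta> \<in> Arr C" "Dom C \<zeta> = Z" "Cod C \<zeta> = fobj B Z"
  and conn_zeta: "conn S (suc k) k \<cdot> \<zeta> = Ide C Z"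
  and zeta_conn: "\<zeta> \<cdot> conn S (suc k) k = Ide C (fobj B Z)"
  using inv_arr_inverse[OF iso] conn_simps[OF S suc_greater(2)[OF k]] S_suc[OF k]
  by (auto simp: is_inverse_def Hom_def)

text \<open>The naturality square of \<tau> from \<open>suc k\<close> to \<open>k\<close>, turned
  around: \<zeta> cancels the connecting map of \<open>S\<close>, and \<open>x\<close> is a section
  of that of \<open>H\<close>. It is used with \<open>x\<close> an identity,
  \<open>farr R \<zeta>\<close> and \<open>farr F \<zeta>\<close>.\<close>

lemma zeta_nat:
  assumes H: "is_functor (Ord_op \<Omega>) C H" and \<tau>: "is_nat (Ord_op \<Omega>) C H S \<tau>"
    and x: "x \<in> Arr C" "Dom C x = fobj H k" "Cod C x = fobj H (suc k)"
    and inv: "conn H (suc k) k \<cdot> x = Ide C (fobj H k)"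
  shows "\<zeta> \<cdot> \<tau> k = \<tau> (suc k) \<cdot> x"
proof -
  note ty = cat_simps x zeta conn_simps[OF H suc_greater(2)[OF k]]
    conn_simps[OF S suc_greater(2)[OF k]] nat_simps[OF \<tau>] k suc_greater(3)[OF k] Z_Obj S_suc[OF k]
  have nat: "conn S (suc k) k \<cdot> \<tau> (suc k) = \<tau> k \<cdot> conn H (suc k) k"
    using nat_naturality[OF \<tau>, of "(k, suc k)"] suc_greater(2)[OF k] by simp
  have "\<zeta> \<cdot> \<tau> k = \<zeta> \<cdot> (\<tau> k \<cdot> (conn H (suc k) k \<cdot> x))"
    unfolding inv by (simp add: ty)
  also have "\<tau> k \<cdot> (conn H (suc k) k \<cdot> x) = conn S (suc k) k \<cdot> (\<tau> (suc k) \<cdot> x)"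
    by (rule Cmp_eq_extend[OF nat[symmetric]]) (simp_all add: ty)
  also have "\<zeta> \<cdot> (conn S (suc k) k \<cdot> (\<tau> (suc k) \<cdot> x)) = (\<zeta> \<cdot> conn S (suc k) k) \<cdot> (\<tau> (suc k) \<cdot> x)"
    by (simp add: ty)
  also have "\<dots> = \<tau> (suc k) \<cdot> x"
    unfolding zeta_conn by (simp add: ty)
  finally show ?thesis .
qed

text \<open>A coalgebra on \<open>x\<close> generates a cone \<tau> over the whole sequence, and
  \<tau> at \<open>k\<close> is a homomorphism by \<open>zeta_nat\<close>. Conversely, every
  homomorphism \<open>h\<close> has the projections \<tau> at all stages up to \<open>k\<close>; the
  projection at \<open>k\<close> itself is \<open>h\<close>.\<close>

lemma final_coalgebra: "is_final_coalgebra C B Z \<zeta>"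
proof -
  have "\<exists>!h. h \<in> Hom C x Z \<and> \<zeta> \<cdot> h = farr B h \<cdot> \<xi>" if "is_coalgebra C B x \<xi>" for x \<xi>
  proof -
    have x: "x \<in> Obj C" and \<xi>: "\<xi> \<in> Arr C" "Dom C \<xi> = x" "Cod C \<xi> = fobj B x"
      using that by (auto simp: is_coalgebra_def Hom_def)
    \<comment> \<open>A natural transformation from the constant diagram at \<open>x\<close> is a
      cone with apex \<open>x\<close>.\<close>
    define H :: "('u, 'u \<times> 'u, 'o, 'm) fctr" where "H = \<lparr>fobj = (\<lambda>_. x), farr = (\<lambda>_. Ide C x)\<rparr>"
    have H: "is_functor (Ord_op \<Omega>) C H"
      using x by (auto simp: is_functor_def H_def Hom_def cat_simps)
    have [simp]: "fobj H i = x" "farr H f = Ide C x" for i f by (simp_all add: H_def)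
    obtain \<tau> where \<tau>: "is_nat (Ord_op \<Omega>) C H S \<tau>"
      and \<tau>_suc: "\<And>i. i \<in> Field \<Omega> \<Longrightarrow> \<tau> (suc i) = farr B (\<tau> i) \<cdot> \<xi>"
    proof (rule nat_by_recursion[OF H, of "\<lambda>i f. farr B f \<cdot> \<xi>"])
      fix i f assume "i \<in> Field \<Omega>" "f \<in> Hom C (fobj H i) (fobj S i)"
      then show "farr B f \<cdot> \<xi> \<in> Hom C (fobj H (suc i)) (fobj S (suc i))"
        by (simp add: Hom_def cat_simps functor_simps[OF B] \<xi> S_suc)
    next
      fix i j f g assume ij: "(i, j) \<in> \<Omega>" and f: "f \<in> Hom C (fobj H i) (fobj S i)"
        and g: "g \<in> Hom C (fobj H j) (fobj S j)" and eq: "conn S j i \<cdot> g = f \<cdot> conn H j i"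
      note ty = cat_simps functor_simps[OF B] \<xi> conn_simps[OF S ij]
      have fg: "f \<in> Arr C" "Dom C f = x" "Cod C f = fobj S i"
        "g \<in> Arr C" "Dom C g = x" "Cod C g = fobj S j"
        using f g by (auto simp: Hom_def)
      have "conn S (suc j) (suc i) \<cdot> (farr B g \<cdot> \<xi>) = farr B (conn S j i \<cdot> g) \<cdot> \<xi>"
        using conn_suc[OF ij] by (simp add: ty fg functor_Cmp[OF B])
      also have "conn S j i \<cdot> g = f" using eq by (simp add: ty fg)
      finally show "conn S (suc j) (suc i) \<cdot> (farr B g \<cdot> \<xi>) = (farr B f \<cdot> \<xi>) \<cdot> conn H (suc j) (suc i)"
        by (simp add: ty fg)
    qed blast
    have \<tau>k: "\<tau> k \<in> Hom C x Z"
      using nat_simps[OF \<tau>, of k] k by (simp add: Hom_def)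
    have ex: "\<zeta> \<cdot> \<tau> k = farr B (\<tau> k) \<cdot> \<xi>"
    proof -
      have "\<zeta> \<cdot> \<tau> k = \<tau> (suc k) \<cdot> Ide C x"
        by (rule zeta_nat[OF H \<tau>]) (simp_all add: x cat_simps)
      then show ?thesis
        using nat_simps[OF \<tau>, of "suc k"] suc_greater(3)[OF k] \<tau>_suc[OF k] by (simp add: cat_simps)
    qed
    have "h = \<tau> k" if h: "h \<in> Hom C x Z" and eq: "\<zeta> \<cdot> h = farr B h \<cdot> \<xi>" for h
    proof -
      have h': "h \<in> Arr C" "Dom C h = x" "Cod C h = Z" using h by (auto simp: Hom_def)
      have t': "\<tau> i \<in> Arr C" "Dom C (\<tau> i) = x" "Cod C (\<tau> i) = fobj S i" if "i \<in> Field \<Omega>" for i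
        using nat_simps[OF \<tau>, of i] that by simp_all
      have "conn S k i \<cdot> h = \<tau> i" if "(i, k) \<in> \<Omega>" for i
        using that
      proof (induction i rule: wf_induct_rule[OF wf_less])
        case (1 i)
        have i: "i \<in> Field \<Omega>" using le_Field 1(2) by blast
        have ty: "conn S k i \<cdot> h \<in> Hom C x (fobj S i)" "\<tau> i \<in> Hom C x (fobj S i)"
          using i by (auto simp: Hom_def cat_simps h' conn_simps[OF S 1(2)] t')
        show ?case using i
        proof (cases rule: ord_cases)
          case zero
          then show ?thesis by (rule terminal_eq[OF _ ty])
        next
          case (suc m)
          have mi: "(m, i) \<in> \<Omega>" "m \<noteq> i" using suc suc_greater[of m] by auto
          have mk: "(m, k) \<in> \<Omega>" using mi 1(2) le_trans by blast
          note ty' = cat_simps functor_simps[OF B] zeta h' \<xi> S_suc k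
            conn_simps[OF S 1(2)] conn_simps[OF S mk] conn_simps[OF S suc_greater(2)[OF k]]
            conn_simps[OF S suc_mono[OF mk]] Z_Obj
          \<comment> \<open>The detour through stage \<open>suc k\<close> makes the homomorphism
            equation of \<open>h\<close> applicable and turns the remaining connecting map into
            \<open>farr B (conn S k m)\<close>, where the hypothesis at \<open>m\<close>
            applies.\<close>
          have "conn S k i \<cdot> h = conn S k i \<cdot> ((conn S (suc k) k \<cdot> \<zeta>) \<cdot> h)"
            unfolding conn_zeta by (simp add: ty')
          also have "\<dots> = (conn S k i \<cdot> conn S (suc k) k) \<cdot> (\<zeta> \<cdot> h)"
            using 1(2) by (simp add: ty')
          also have "\<dots> = conn S (suc k) (suc m) \<cdot> (farr B h \<cdot> \<xi>)"
            using conn_Cmp[OF S 1(2) suc_greater(2)[OF k]] eq suc by simp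
          also have "\<dots> = farr B (conn S k m \<cdot> h) \<cdot> \<xi>"
            using conn_suc[OF mk] by (simp add: ty' functor_Cmp[OF B])
          also have "\<dots> = \<tau> i"
            using 1(1)[of m] mi mk \<tau>_suc suc by simp
          finally show ?thesis .
        next
          case limit
          show ?thesis
          proof (rule limit_eq[OF limit ty])
            fix n assume "n \<in> underS \<Omega> i"
            then have ni: "(n, i) \<in> \<Omega>" "n \<noteq> i" by (auto simp: underS_def)
            have nk: "(n, k) \<in> \<Omega>" using ni 1(2) le_trans by blast
            have "conn S i n \<cdot> (conn S k i \<cdot> h) = (conn S i n \<cdot> conn S k i) \<cdot> h"
              by (simp add: cat_simps h' conn_simps[OF S 1(2)] conn_simps[OF S ni(1)])
            also have "\<dots> = \<tau> n"
              using conn_Cmp[OF S ni(1) 1(2)] 1(1)[of n] ni nk by simp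
            also have "\<dots> = conn S i n \<cdot> \<tau> i"
              using nat_naturality[OF \<tau>, of "(n, i)" i n] ni t'[of n] le_Field[OF ni(1)]
              by (simp add: cat_simps)
            finally show "conn S i n \<cdot> (conn S k i \<cdot> h) = conn S i n \<cdot> \<tau> i" .
          qed
        qed
      qed
      from this[OF le_refl[OF k]] show ?thesis
        using k h' by (simp add: conn_refl[OF S] cat_simps)
    qed
    then show ?thesis using \<tau>k ex by blast
  qed
  then show ?thesis
    using zeta Z_Obj by (auto simp: is_final_coalgebra_def is_coalgebra_def Hom_def)
qed

text \<open>The solutions are exactly the coalgebra homomorphisms into \<zeta> from
  \<open>G Z\<close> with structure \<open>\<rho> Z \<cdot> farr G \<zeta>\<close>; finality makes
  them unique.\<close>

lemma dlaw_induced_of_solution: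
  assumes G: "is_functor C C G" and \<rho>: "is_nat C C (G \<circ>\<^sub>F B) (B \<circ>\<^sub>F G) \<rho>"
    and \<beta>: "is_algebra C G Z \<beta>" "dlaw_equation C B G \<rho> Z \<zeta> \<beta>"
  shows "dlaw_induced C B G \<rho> Z \<zeta> \<beta>"
proof -
  have "is_coalgebra C B (fobj G Z) (\<rho> Z \<cdot> farr G \<zeta>)"
    using Z_Obj zeta
    by (simp add: is_coalgebra_def Hom_def cat_simps functor_simps[OF G] nat_simps[OF \<rho>])
  then have "\<exists>!h. h \<in> Hom C (fobj G Z) Z \<and> \<zeta> \<cdot> h = farr B h \<cdot> (\<rho> Z \<cdot> farr G \<zeta>)"
    using final_coalgebra by (simp add: is_final_coalgebra_def)
  then show ?thesis
    using \<beta> by (auto simp: dlaw_induced_def dlaw_equation_def is_algebra_def)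
qed

end

section \<open>The codensity monad as a distributive law\<close>

context stable_final_sequence
begin

text \<open>The law \<rho> comes from the universal property of \<open>B \<circ>\<^sub>F R\<close>,
  and its defining equation at stage \<open>k\<close> becomes the equation for the induced algebra
  once \<open>\<epsilon> (suc k)\<close> is traded for \<open>\<epsilon> k\<close> along
  \<zeta>.\<close>

lemma codensity_dlaw:
  assumes cod: "is_codensity (Ord_op \<Omega>) C S R \<epsilon>"
    and pres: "preserves_codensity (Ord_op \<Omega>) C B S R \<epsilon>"
  obtains \<rho> where "is_nat C C (R \<circ>\<^sub>F B) (B \<circ>\<^sub>F R) \<rho>" "dlaw_induced C B R \<rho> Z \<zeta> (\<epsilon> k)"
proof -
  have R: "is_functor C C R" and \<epsilon>: "is_nat (Ord_op \<Omega>) C (R \<circ>\<^sub>F S) S \<epsilon>"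
    using cod by (auto simp: is_codensity_def is_right_kan_extension_def)
  have RB: "is_functor C C (R \<circ>\<^sub>F B)" by (rule is_functor_comp[OF B R])
  \<comment> \<open>The index shift is well typed because stage \<open>suc i\<close> is literally
    \<open>B\<close> applied to stage \<open>i\<close>; naturality is that of \<epsilon> at the
    shifted arrow, by \<open>conn_suc\<close>.\<close>
  have "is_nat (Ord_op \<Omega>) C ((R \<circ>\<^sub>F B) \<circ>\<^sub>F S) (B \<circ>\<^sub>F S) (\<lambda>i. \<epsilon> (suc i))"
    unfolding is_nat_def
  proof (intro conjI ballI)
    fix i assume "i \<in> Obj (Ord_op \<Omega>)"
    then show "\<epsilon> (suc i) \<in> Hom C (fobj ((R \<circ>\<^sub>F B) \<circ>\<^sub>F S) i) (fobj (B \<circ>\<^sub>F S) i)"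
      using nat_simps[OF \<epsilon>, of "suc i"] suc_greater(3)[of i] S_suc[of i] by (simp add: Hom_def)
  next
    fix f assume "f \<in> Arr (Ord_op \<Omega>)"
    then obtain i j where f: "f = (i, j)" "(i, j) \<in> \<Omega>" by (cases f) auto
    then show "farr (B \<circ>\<^sub>F S) f \<cdot> \<epsilon> (suc (Dom (Ord_op \<Omega>) f))
        = \<epsilon> (suc (Cod (Ord_op \<Omega>) f)) \<cdot> farr ((R \<circ>\<^sub>F B) \<circ>\<^sub>F S) f"
      using nat_naturality[OF \<epsilon>, of "(suc i, suc j)" "suc j" "suc i"] suc_mono[of i j] conn_suc[of i j] by simp
  qed (intro is_functor_comp[OF S] RB B)+
  then obtain \<rho> where \<rho>: "is_nat C C (R \<circ>\<^sub>F B) (B \<circ>\<^sub>F R) \<rho>"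
    and \<rho>\<epsilon>: "\<forall>i \<in> Field \<Omega>. \<epsilon> (suc i) = farr B (\<epsilon> i) \<cdot> \<rho> (fobj S i)"
    using pres RB unfolding preserves_codensity_def is_right_kan_extension_def Ord_op_simps by blast
  have e: "\<epsilon> k \<in> Arr C" "Dom C (\<epsilon> k) = fobj R Z" "Cod C (\<epsilon> k) = Z"
    using nat_simps[OF \<epsilon>, of k] k by simp_all
  have "\<zeta> \<cdot> \<epsilon> k = \<epsilon> (suc k) \<cdot> farr R \<zeta>"
  proof (rule zeta_nat[OF is_functor_comp[OF S R] \<epsilon>])
    have "conn (R \<circ>\<^sub>F S) (suc k) k \<cdot> farr R \<zeta> = farr R (conn S (suc k) k \<cdot> \<zeta>)"
      using conn_simps[OF S suc_greater(2)[OF k]] zeta S_suc[OF k] by (simp add: functor_Cmp[OF R])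
    then show "conn (R \<circ>\<^sub>F S) (suc k) k \<cdot> farr R \<zeta> = Ide C (fobj (R \<circ>\<^sub>F S) k)"
      by (simp add: conn_zeta functor_simps[OF R] Z_Obj)
  qed (simp_all add: functor_simps[OF R] zeta S_suc[OF k])
  also have "\<dots> = farr B (\<epsilon> k) \<cdot> (\<rho> Z \<cdot> farr R \<zeta>)"
    using \<rho>\<epsilon> k by (simp add: cat_simps functor_simps[OF R] functor_simps[OF B] zeta e nat_simps[OF \<rho>] Z_Obj)
  finally have "dlaw_induced C B R \<rho> Z \<zeta> (\<epsilon> k)"
    by (intro dlaw_induced_of_solution[OF R \<rho>])
      (simp_all add: dlaw_equation_def is_algebra_def Hom_def e Z_Obj)
  then show thesis using that \<rho> by blast
qed

text \<open>Nothing about GSOS enters here: any algebra that extends to the whole sequence factors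
  through \<open>\<epsilon> k\<close>, with \<kappa> given by the universal property of
  \<open>R\<close>. The functor, \<rho> and \<beta> are the same for all \<open>F\<close>.\<close>

lemma definable_by_dlaw_of_nat:
  assumes cod: "is_codensity (Ord_op \<Omega>) C S R \<epsilon>"
    and pres: "preserves_codensity (Ord_op \<Omega>) C B S R \<epsilon>"
    and F: "is_functor C C F" and \<tau>: "is_nat (Ord_op \<Omega>) C (F \<circ>\<^sub>F S) S \<tau>"
  shows "definable_by_dlaw C B F Z \<zeta> (\<tau> k)"
proof -
  obtain \<rho> where \<rho>: "is_nat C C (R \<circ>\<^sub>F B) (B \<circ>\<^sub>F R) \<rho>" "dlaw_induced C B R \<rho> Z \<zeta> (\<epsilon> k)"
    using codensity_dlaw[OF cod pres] .
  obtain \<kappa> where "is_nat C C F R \<kappa>" "\<forall>i \<in> Field \<Omega>. \<tau> i = \<epsilon> i \<cdot> \<kappa> (fobj S i)"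
    using cod F \<tau> unfolding is_codensity_def is_right_kan_extension_def Ord_op_simps by blast
  moreover have "is_functor C C R"
    using cod by (simp add: is_codensity_def is_right_kan_extension_def)
  ultimately show ?thesis
    unfolding definable_by_dlaw_def using \<rho> k by blast
qed

end

section \<open>Interpreting a GSOS specification along the final sequence\<close>

lemma (in category) pairing_props:
  assumes pr: "is_product C a b c p q" and f: "f \<in> Hom C x a" and g: "g \<in> Hom C x b"
  shows "pairing C p q f g \<in> Hom C x c" "p \<cdot> pairing C p q f g = f" "q \<cdot> pairing C p q f g = g"
proof -
  have "\<exists>!h. h \<in> Hom C x c \<and> p \<cdot> h = f \<and> q \<cdot> h = g"
    using pr f g Dom_Obj unfolding is_product_def Hom_def by blast
  then have "\<exists>!h. h \<in> Hom C (Dom C f) (Dom C p) \<and> p \<cdot> h = f \<and> q \<cdot> h = g"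
    using pr f by (simp add: is_product_def Hom_def)
  from theI'[OF this]
  show "pairing C p q f g \<in> Hom C x c" "p \<cdot> pairing C p q f g = f" "q \<cdot> pairing C p q f g = g"
    using pr f by (simp_all add: pairing_def is_product_def Hom_def)
qed

lemma (in category) product_eq:
  assumes pr: "is_product C a b c p q" and f: "f \<in> Hom C x c" and g: "g \<in> Hom C x c"
    and eq: "p \<cdot> f = p \<cdot> g" "q \<cdot> f = q \<cdot> g"
  shows "f = g"
proof -
  have "x \<in> Obj C" using f Dom_Obj by (auto simp: Hom_def)
  moreover have "p \<cdot> f \<in> Hom C x a" "q \<cdot> f \<in> Hom C x b"
    using pr f by (auto simp: is_product_def intro: Cmp_Hom)
  ultimately have "\<exists>!h. h \<in> Hom C x c \<and> p \<cdot> h = p \<cdot> f \<and> q \<cdot> h = q \<cdot> f"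
    using pr by (simp add: is_product_def)
  then show ?thesis using f g eq by metis
qed

section \<open>The algebras on the stages of the final sequence\<close>

locale gsos = stable_final_sequence C \<Omega> B S k + free_monad C F T \<eta> \<mu> \<iota>
  for C :: "('o, 'm) cat" (structure) and \<Omega> :: "'u rel" and B S k F T \<eta> \<mu> \<iota> +
  fixes P :: "('o, 'm, 'o, 'm) fctr" and p q l :: "'o \<Rightarrow> 'm"
  assumes P: "is_product_fctr C B id_fctr P p q" and l: "is_nat C C (F \<circ>\<^sub>F P) (B \<circ>\<^sub>F T) l"
begin

lemma p: "is_nat C C P B p" and q: "is_nat C C P id_fctr q" and P_functor: "is_functor C C P"
  using P by (auto simp: is_product_fctr_def is_nat_def)

lemma product: "x \<in> Obj C \<Longrightarrow> is_product C (fobj B x) x (fobj P x) (p x) (q x)"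
  using P by (simp add: is_product_fctr_def)

text \<open>The substitute for the pairing of \<zeta> with the identity at stages where no \<zeta>
  is available: stage \<open>suc i\<close> is \<open>B\<close> of stage \<open>i\<close>, so the
  identity serves as unfolding and the connecting map as the state component.\<close>

definition unfold_pair :: "'u \<Rightarrow> 'm" where
  "unfold_pair i = pairing C (p (fobj S i)) (q (fobj S i)) (Ide C (fobj S (suc i))) (conn S (suc i) i)"

text \<open>The right-hand side of the GSOS equation with \<open>unfold_pair\<close> as input: an
  algebra on stage \<open>i\<close> yields one on stage \<open>suc i\<close>.\<close>

definition step :: "'u \<Rightarrow> 'm \<Rightarrow> 'm" where
  "step i a = farr B (ext (fobj S i) a) \<cdot> (l (fobj S i) \<cdot> farr F (unfold_pair i))"

lemma unfold_pair:
  assumes i: "i \<in> Field \<Omega>"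
  shows "unfold_pair i \<in> Arr C" "Dom C (unfold_pair i) = fobj B (fobj S i)"
    "Cod C (unfold_pair i) = fobj P (fobj S i)"
    "p (fobj S i) \<cdot> unfold_pair i = Ide C (fobj B (fobj S i))"
    "q (fobj S i) \<cdot> unfold_pair i = conn S (suc i) i"
proof -
  have Si: "fobj S i \<in> Obj C" by (rule fobj_Obj[OF S i])
  have "Ide C (fobj S (suc i)) \<in> Hom C (fobj B (fobj S i)) (fobj B (fobj S i))"
    "conn S (suc i) i \<in> Hom C (fobj B (fobj S i)) (fobj S i)"
    using S_suc[OF i] Si conn_simps[OF S suc_greater(2)[OF i]]
    by (simp_all add: Hom_def cat_simps functor_simps[OF B])
  note * = pairing_props[OF product[OF Si] this]
  show "unfold_pair i \<in> Arr C" "Dom C (unfold_pair i) = fobj B (fobj S i)"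
    "Cod C (unfold_pair i) = fobj P (fobj S i)"
    "p (fobj S i) \<cdot> unfold_pair i = Ide C (fobj B (fobj S i))"
    "q (fobj S i) \<cdot> unfold_pair i = conn S (suc i) i"
    using * S_suc[OF i] by (simp_all add: unfold_pair_def Hom_def)
qed

text \<open>Checked on the two projections. The first is naturality of \<open>p\<close>. The second
  compares the paths from stage \<open>suc j\<close> to stage \<open>i\<close> through
  \<open>j\<close> and through \<open>suc i\<close>.\<close>

lemma unfold_pair_nat:
  assumes ij: "(i, j) \<in> \<Omega>"
  shows "farr P (conn S j i) \<cdot> unfold_pair j = unfold_pair i \<cdot> farr B (conn S j i)"
proof -
  have i: "i \<in> Field \<Omega>" and j: "j \<in> Field \<Omega>" using le_Field ij by auto
  have Si: "fobj S i \<in> Obj C" and Sj: "fobj S j \<in> Obj C" using fobj_Obj[OF S] i j by auto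
  note ty = cat_simps functor_simps[OF B] functor_simps[OF P_functor] nat_simps[OF p] nat_simps[OF q]
    unfold_pair[OF i] unfold_pair[OF j] conn_simps[OF S ij] Si Sj
  have suci: "(i, suc i) \<in> \<Omega>" "(j, suc j) \<in> \<Omega>" using suc_greater i j by auto
  show ?thesis
  proof (rule product_eq[OF product[OF Si]])
    show "farr P (conn S j i) \<cdot> unfold_pair j \<in> Hom C (fobj B (fobj S j)) (fobj P (fobj S i))"
      "unfold_pair i \<cdot> farr B (conn S j i) \<in> Hom C (fobj B (fobj S j)) (fobj P (fobj S i))"
      by (simp_all add: Hom_def ty)
    have "p (fobj S i) \<cdot> (farr P (conn S j i) \<cdot> unfold_pair j)
        = farr B (conn S j i) \<cdot> (p (fobj S j) \<cdot> unfold_pair j)"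
      by (intro Cmp_eq_extend nat_naturality[OF p]) (simp_all add: ty)
    also have "\<dots> = farr B (conn S j i)" by (simp add: ty)
    also have "\<dots> = (p (fobj S i) \<cdot> unfold_pair i) \<cdot> farr B (conn S j i)"
      unfolding unfold_pair(4)[OF i] by (simp add: ty)
    also have "\<dots> = p (fobj S i) \<cdot> (unfold_pair i \<cdot> farr B (conn S j i))"
      by (rule Cmp_assoc_right) (simp_all add: ty)
    finally show "p (fobj S i) \<cdot> (farr P (conn S j i) \<cdot> unfold_pair j)
        = p (fobj S i) \<cdot> (unfold_pair i \<cdot> farr B (conn S j i))" .
    have qn: "q (fobj S i) \<cdot> farr P (conn S j i) = conn S j i \<cdot> q (fobj S j)"
      using nat_naturality[OF q, of "conn S j i"] by (simp add: ty)
    have "q (fobj S i) \<cdot> (farr P (conn S j i) \<cdot> unfold_pair j)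
        = conn S j i \<cdot> (q (fobj S j) \<cdot> unfold_pair j)"
      by (rule Cmp_eq_extend[OF qn]) (simp_all add: ty)
    also have "\<dots> = conn S j i \<cdot> conn S (suc j) j" by (simp add: ty)
    also have "\<dots> = conn S (suc i) i \<cdot> conn S (suc j) (suc i)"
      using conn_Cmp[OF S ij suci(2)] conn_Cmp[OF S suci(1) suc_mono[OF ij]] by simp
    also have "\<dots> = (q (fobj S i) \<cdot> unfold_pair i) \<cdot> farr B (conn S j i)"
      using conn_suc[OF ij] unfold_pair(5)[OF i] by simp
    also have "\<dots> = q (fobj S i) \<cdot> (unfold_pair i \<cdot> farr B (conn S j i))"
      by (rule Cmp_assoc_right) (simp_all add: ty)
    finally show "q (fobj S i) \<cdot> (farr P (conn S j i) \<cdot> unfold_pair j)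
        = q (fobj S i) \<cdot> (unfold_pair i \<cdot> farr B (conn S j i))" .
  qed
qed

lemma algebra_on_S:
  "i \<in> Field \<Omega> \<Longrightarrow> a \<in> Hom C (fobj F (fobj S i)) (fobj S i) \<Longrightarrow> is_algebra C F (fobj S i) a"
  using fobj_Obj[OF S] by (simp add: is_algebra_def)

lemma ext_S:
  assumes "i \<in> Field \<Omega>" "a \<in> Hom C (fobj F (fobj S i)) (fobj S i)"
  shows "ext (fobj S i) a \<in> Arr C" "Dom C (ext (fobj S i) a) = fobj T (fobj S i)"
    "Cod C (ext (fobj S i) a) = fobj S i"
  using ext_props(1)[OF algebra_on_S[OF assms]] by (auto simp: Hom_def)

text \<open>Three squares are pasted: \<open>ext_hom\<close> under \<open>B\<close>, naturality of
  \<open>l\<close>, and \<open>unfold_pair_nat\<close> under \<open>F\<close>.\<close>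

lemma step_nat:
  assumes ij: "(i, j) \<in> \<Omega>" and a: "a \<in> Hom C (fobj F (fobj S i)) (fobj S i)"
    and b: "b \<in> Hom C (fobj F (fobj S j)) (fobj S j)"
    and eq: "conn S j i \<cdot> b = a \<cdot> farr F (conn S j i)"
  shows "conn S (suc j) (suc i) \<cdot> step j b = step i a \<cdot> farr F (conn S (suc j) (suc i))"
proof -
  let ?c = "conn S j i" and ?x = "fobj S i" and ?y = "fobj S j"
  have i: "i \<in> Field \<Omega>" and j: "j \<in> Field \<Omega>" using le_Field ij by auto
  have Si: "?x \<in> Obj C" and Sj: "?y \<in> Obj C" using fobj_Obj[OF S] i j by auto
  note ty = typing functor_simps[OF B] functor_simps[OF P_functor] nat_simps[OF l]
    unfold_pair(1-3)[OF i] unfold_pair(1-3)[OF j] conn_simps[OF S ij] Si Sj ext_S[OF i a] ext_S[OF j b]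
  \<comment> \<open>The assumption \<open>eq\<close> says that the connecting map is an
    \<open>F\<close>-algebra morphism from \<open>b\<close> to \<open>a\<close>.\<close>
  have "?c \<cdot> ext ?y b = ext ?x a \<cdot> farr T ?c"
    by (rule ext_hom[OF algebra_on_S[OF j b] algebra_on_S[OF i a] _ eq]) (simp add: Hom_def ty)
  then have "farr B (?c \<cdot> ext ?y b) = farr B (ext ?x a \<cdot> farr T ?c)" by simp
  then have Bext: "farr B ?c \<cdot> farr B (ext ?y b) = farr B (ext ?x a) \<cdot> farr B (farr T ?c)"
    by (simp add: functor_Cmp[OF B] ty)
  have "farr F (farr P ?c \<cdot> unfold_pair j) = farr F (unfold_pair i \<cdot> farr B ?c)"
    by (simp add: unfold_pair_nat[OF ij])
  then have Fpair: "farr F (farr P ?c) \<cdot> farr F (unfold_pair j)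
      = farr F (unfold_pair i) \<cdot> farr F (farr B ?c)"
    by (simp add: functor_Cmp[OF F] ty)
  have lc: "farr B (farr T ?c) \<cdot> l ?y = l ?x \<cdot> farr F (farr P ?c)"
    using nat_naturality[OF l, of ?c] by (simp add: ty)
  have "farr B ?c \<cdot> step j b = farr B (ext ?x a) \<cdot> (farr B (farr T ?c) \<cdot> (l ?y \<cdot> farr F (unfold_pair j)))"
    unfolding step_def by (rule Cmp_eq_extend[OF Bext]) (simp_all add: ty)
  also have "farr B (farr T ?c) \<cdot> (l ?y \<cdot> farr F (unfold_pair j))
      = l ?x \<cdot> (farr F (farr P ?c) \<cdot> farr F (unfold_pair j))"
    by (rule Cmp_eq_extend[OF lc]) (simp_all add: ty)
  also have "farr B (ext ?x a) \<cdot> (l ?x \<cdot> (farr F (farr P ?c) \<cdot> farr F (unfold_pair j)))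
      = step i a \<cdot> farr F (farr B ?c)"
    unfolding Fpair step_def by (simp add: ty)
  finally show ?thesis by (simp add: conn_suc[OF ij])
qed

lemma gsos_algebras:
  obtains \<tau> where "is_nat (Ord_op \<Omega>) C (F \<circ>\<^sub>F S) S \<tau>" "\<And>i. i \<in> Field \<Omega> \<Longrightarrow> \<tau> (suc i) = step i (\<tau> i)"
proof (rule nat_by_recursion[OF is_functor_comp[OF S F], of step])
  fix i f assume i: "i \<in> Field \<Omega>" and "f \<in> Hom C (fobj (F \<circ>\<^sub>F S) i) (fobj S i)"
  then have f: "f \<in> Hom C (fobj F (fobj S i)) (fobj S i)" by simp
  show "step i f \<in> Hom C (fobj (F \<circ>\<^sub>F S) (suc i)) (fobj S (suc i))"
    by (simp add: Hom_def step_def typing functor_simps[OF B] nat_simps[OF l] unfold_pair[OF i]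
        ext_S[OF i f] fobj_Obj[OF S i] S_suc[OF i])
qed (use step_nat in auto)

text \<open>At the stable stage the substitute becomes the pairing of the GSOS equation: its state
  component is the connecting map after \<zeta>, which is the identity.\<close>

lemma unfold_pair_zeta:
  "unfold_pair k \<cdot> \<zeta> = pairing C (p Z) (q Z) \<zeta> (Ide C Z)"
proof (rule product_eq[OF product[OF Z_Obj]])
  note ty = cat_simps zeta unfold_pair(1-3)[OF k] nat_simps[OF p] nat_simps[OF q] Z_Obj
    functor_simps[OF B]
  have *: "\<zeta> \<in> Hom C Z (fobj B Z)" "Ide C Z \<in> Hom C Z Z"
    by (simp_all add: Hom_def ty)
  note pp = pairing_props[OF product[OF Z_Obj] *]
  show "pairing C (p Z) (q Z) \<zeta> (Ide C Z) \<in> Hom C Z (fobj P Z)" by (rule pp)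
  show "unfold_pair k \<cdot> \<zeta> \<in> Hom C Z (fobj P Z)" by (simp add: Hom_def ty)
  have "p Z \<cdot> (unfold_pair k \<cdot> \<zeta>) = (p Z \<cdot> unfold_pair k) \<cdot> \<zeta>" by (simp add: ty)
  also have "\<dots> = \<zeta>" unfolding unfold_pair(4)[OF k] by (simp add: ty)
  finally show "p Z \<cdot> (unfold_pair k \<cdot> \<zeta>) = p Z \<cdot> pairing C (p Z) (q Z) \<zeta> (Ide C Z)"
    by (simp add: pp)
  have "q Z \<cdot> (unfold_pair k \<cdot> \<zeta>) = (q Z \<cdot> unfold_pair k) \<cdot> \<zeta>" by (simp add: ty)
  also have "\<dots> = Ide C Z" unfolding unfold_pair(5)[OF k] by (rule conn_zeta)
  finally show "q Z \<cdot> (unfold_pair k \<cdot> \<zeta>) = q Z \<cdot> pairing C (p Z) (q Z) \<zeta> (Ide C Z)"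
    by (simp add: pp)
qed

text \<open>By \<open>zeta_nat\<close> the recursion equation at \<open>suc k\<close> is precomposed
  with \<open>farr F \<zeta>\<close>, which merges with
  \<open>farr F (unfold_pair k)\<close>.\<close>

lemma gsos_equation_at_Z:
  assumes \<tau>: "is_nat (Ord_op \<Omega>) C (F \<circ>\<^sub>F S) S \<tau>" and "\<tau> (suc k) = step k (\<tau> k)"
  shows "gsos_equation C B F T \<eta> \<mu> \<iota> p q l Z \<zeta> (\<tau> k)"
proof -
  have t: "\<tau> k \<in> Hom C (fobj F Z) Z" using nat_simps[OF \<tau>, of k] k by (simp add: Hom_def)
  note ty = typing functor_simps[OF B] nat_simps[OF l] unfold_pair(1-3)[OF k] ext_S[OF k t] zeta Z_Obj
  have "\<zeta> \<cdot> \<tau> k = \<tau> (suc k) \<cdot> farr F \<zeta>"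
  proof (rule zeta_nat[OF is_functor_comp[OF S F] \<tau>])
    have "conn (F \<circ>\<^sub>F S) (suc k) k \<cdot> farr F \<zeta> = farr F (conn S (suc k) k \<cdot> \<zeta>)"
      using conn_simps[OF S suc_greater(2)[OF k]] S_suc[OF k] by (simp add: functor_Cmp[OF F] zeta)
    then show "conn (F \<circ>\<^sub>F S) (suc k) k \<cdot> farr F \<zeta> = Ide C (fobj (F \<circ>\<^sub>F S) k)"
      by (simp add: conn_zeta ty)
  qed (simp_all add: ty S_suc[OF k])
  also have "\<dots> = farr B (ext Z (\<tau> k)) \<cdot> (l Z \<cdot> farr F (unfold_pair k \<cdot> \<zeta>))"
    unfolding assms(2) step_def by (simp add: ty functor_Cmp[OF F])
  finally show ?thesis unfolding gsos_equation_def unfold_pair_zeta .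
qed

text \<open>The component \<open>\<tau> k\<close> solves the GSOS equation, and the uniqueness built
  into \<open>gsos_induced\<close> identifies it with \<alpha>.\<close>

lemma gsos_definable:
  assumes cod: "is_codensity (Ord_op \<Omega>) C S R \<epsilon>"
    and pres: "preserves_codensity (Ord_op \<Omega>) C B S R \<epsilon>"
    and \<alpha>: "gsos_induced C B F T \<eta> \<mu> \<iota> p q l Z \<zeta> \<alpha>"
  shows "definable_by_dlaw C B F Z \<zeta> \<alpha>"
proof -
  obtain \<tau> where \<tau>: "is_nat (Ord_op \<Omega>) C (F \<circ>\<^sub>F S) S \<tau>"
    and suc: "\<And>i. i \<in> Field \<Omega> \<Longrightarrow> \<tau> (suc i) = step i (\<tau> i)"
    using gsos_algebras by blast
  have "is_algebra C F Z (\<tau> k)"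
    using nat_simps[OF \<tau>, of k] k Z_Obj by (simp add: is_algebra_def Hom_def)
  then have "\<tau> k = \<alpha>"
    using \<alpha> gsos_equation_at_Z[OF \<tau> suc[OF k]] by (simp add: gsos_induced_def)
  then show ?thesis using definable_by_dlaw_of_nat[OF cod pres F \<tau>] by simp
qed

end

theorem theorem10p2:
  fixes C :: "('o, 'm) cat" and \<Omega> :: "'u rel"
    and B F T P R :: "('o, 'm, 'o, 'm) fctr"
    and S :: "('u, 'u \<times> 'u, 'o, 'm) fctr"
    and \<epsilon> :: "'u \<Rightarrow> 'm" and \<eta> \<mu> \<iota> p q :: "'o \<Rightarrow> 'm" and k :: 'u
  assumes "universe_size \<Omega>"
    and "complete_category \<Omega> C"
    and "is_functor C C B"
    and "is_final_sequence \<Omega> C B S"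
    and "is_codensity (Ord_op \<Omega>) C S R \<epsilon>"
    and "preserves_codensity (Ord_op \<Omega>) C B S R \<epsilon>"
    and "k \<in> Field \<Omega>"
    and "is_iso C (conn S (ord_suc \<Omega> k) k)"
    and "is_functor C C F"
    and "is_free_monad C F T \<eta> \<mu> \<iota>"
    and "is_product_fctr C B id_fctr P p q"
  shows "is_final_coalgebra C B (fobj S k) (inv_arr C (conn S (ord_suc \<Omega> k) k)) \<and>
    (\<forall>l \<alpha>. is_nat C C (F \<circ>\<^sub>F P) (B \<circ>\<^sub>F T) l \<longrightarrow>
      gsos_induced C B F T \<eta> \<mu> \<iota> p q l (fobj S k) (inv_arr C (conn S (ord_suc \<Omega> k) k)) \<alpha> \<longrightarrow>
      definable_by_dlaw C B F (fobj S k) (inv_arr C (conn S (ord_suc \<Omega> k) k)) \<alpha>)"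
proof -
  interpret stable_final_sequence C \<Omega> B S k
    using assms unfolding complete_category_def
    by (intro stable_final_sequence.intro final_sequence.intro ordinals.intro
        final_sequence_axioms.intro stable_final_sequence_axioms.intro) auto
  show ?thesis
  proof (intro conjI allI impI)
    show "is_final_coalgebra C B (fobj S k) (inv_arr C (conn S (ord_suc \<Omega> k) k))"
      by (rule final_coalgebra)
    fix l \<alpha> assume l: "is_nat C C (F \<circ>\<^sub>F P) (B \<circ>\<^sub>F T) l"
      and \<alpha>: "gsos_induced C B F T \<eta> \<mu> \<iota> p q l (fobj S k) (inv_arr C (conn S (ord_suc \<Omega> k) k)) \<alpha>"
    \<comment> \<open>The specification \<open>l\<close> is quantified in the conclusion, so the
      locale is entered only after \<open>l\<close> is fixed.\<close>
    interpret gsos C \<Omega> B S k F T \<eta> \<mu> \<iota> P p q l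
      using assms l by unfold_locales auto
    show "definable_by_dlaw C B F (fobj S k) (inv_arr C (conn S (ord_suc \<Omega> k) k)) \<alpha>"
      using gsos_definable assms \<alpha> by blast
  qed
qed

end
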